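(* The quantum discrete Painlevé VI equation is a discrete Hamiltonian flow. Precisely, let $T_3=s_2s_1s_0s_2s_3s_4s_5s_3\,\sigma$, $\sigma=\sigma_{01}\sigma_{45}$, be the automorphism of the skew field $\boldsymbol F=\boldsymbol K(F,G)$, $FG=qGF$, described in the context, and let $S_0,\dots,S_5,\Sigma$ be the elements defined in the context. Then $$T_3=Ad\left(S_2S_1S_0S_2S_3S_4S_5S_3\,\Sigma\right),$$ where $Ad(X)(\phi)=X\phi X^{-1}$.
   Context: The Dynkin diagram of type $D_5^{(1)}$ is numbered so that node $2$ is joined to $0,1,3$ and node $3$ is joined to $2,4,5$ (no other edges); $[a_{ij}]_{i,j=0}^5$ is the corresponding generalized Cartan matrix ($a_{ii}=2$, $a_{ij}=-1$ if $i,j$ are joined, $0$ otherwise), with simple roots $\alpha_0,\dots,\alpha_5$. Write $a_j=e^{\alpha_j}$ and $\boldsymbol K=\mathbb C(a_0,\dots,a_5)$. $q$ is a formal central letter (or a complex parameter with $|q|<1$). $\boldsymbol F=\boldsymbol K(F,G)$ is the skew field of fractions of the $\boldsymbol K$-algebra generated by $F,G$ with $FG=qGF$, where $\boldsymbol K$ and $q$ are central. A fraction $\frac AB$ with commuting $A,B$ means $AB^{-1}$. Infinite products below are understood in the $q$-adic completion of $\boldsymbol F$. Automorphisms $s_0,\dots,s_5$ of $\boldsymbol F$ (an action of the Weyl group $W(D_5^{(1)})$): $s_i(a_j)=a_i^{-a_{ij}}a_j$, $$s_2(F)=F\,\frac{a_0a_1^{-1}G+a_2^2}{a_0a_1^{-1}a_2^2G+1},\quad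 s_j(F)=F\ (j\ne2),\qquad s_3(G)=\frac{a_3^2a_4a_5^{-1}F+1}{a_4a_5^{-1}F+a_3^2}\,G,\quad s_j(G)=G\ (j\neq3).$$ Involutive antiautomorphisms of $\boldsymbol F$: $\sigma_{01}:a_0\mapsto a_1^{-1},\ a_1\mapsto a_0^{-1},\ a_j\mapsto a_j^{-1}\ (j\ne0,1),\ F\mapsto q^{-1}F^{-1},\ G\mapsto G$; $\sigma_{45}:a_4\mapsto a_5^{-1},\ a_5\mapsto a_4^{-1},\ a_j\mapsto a_j^{-1}\ (j\neq4,5),\ F\mapsto F,\ G\mapsto q^{-1}G^{-1}$. Their composite $\sigma=\sigma_{01}\sigma_{45}$ is an automorphism of $\boldsymbol F$. Products such as $T_3$ are compositions of maps; the discrete flow generated by $T_3$ is the quantum discrete Painlevé VI equation. Put $(x,q)_\infty:=\prod_{m=0}^\infty(1+xq^m)$ (note the plus sign), $\theta(X):=(X,q)_\infty(qX^{-1},q)_\infty$, and for $z$ central $$\Psi(z,X):=\frac{(qX,q)_\infty\,(X^{-1},q)_\infty}{(zqX,q)_\infty\,(zX^{-1},q)_\infty}.$$ Let $\partial_j$ and $\partial'_j$ ($j=0,\dots,5$) be letters commuting with $F,G$ and satisfying $[\partial_j,\alpha_k]=a_{jk}$ (so $[\partial_j,a_k]=a_{jk}a_k$) and $[\partial'_j,\alpha_k]=\delta_{jk}$. Put $\rho_j:=e^{\frac{\pi}{2}\sqrt{-1}\,\alpha_j\partial_j}$. Define $$S_2=\Psi(a_2^2,a_0a_1^{-1}G)\,\rho_2,\qquad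 S_3=\Psi(a_3^2,a_5a_4^{-1}F)\,\rho_3,\qquad S_j=\rho_j\ (j\ne2,3),$$ $$\Sigma:=\theta(qFG)\,\theta(G^{-1}F)\,\theta(qF)^4\;e^{\frac{\pi}{2}\sqrt{-1}(\alpha_0+\alpha_1)(\partial'_0+\partial'_1)}\;e^{\pi\sqrt{-1}\alpha_2\partial'_2}\;e^{\pi\sqrt{-1}\alpha_3\partial'_3}\;e^{\frac{\pi}{2}\sqrt{-1}(\alpha_4+\alpha_5)(\partial'_4+\partial'_5)}.$$
   Formalization: Corrected: S_3 uses a_4a_5^{-1}F; Σ's exponents are (πi/2)(α_0−α_1)(∂'_0−∂'_1) and (πi/2)(α_4−α_5)(∂'_4−∂'_5), with no α_2, α_3 factors (printed Σ sends a_2 to a_2^{-1}, but σ(a_2)=a_2). Ad of infinite products is the limit of Ad of partial products. *)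

theory Defs
  imports
    "HOL-Analysis.Analysis"
    "HOL-Computational_Algebra.Polynomial"
begin

section \<open>Ring homomorphisms, units, commutators\<close>

definition is_ring_hom :: "('r::ring_1 \<Rightarrow> 's::ring_1) \<Rightarrow> bool" where
  "is_ring_hom f \<longleftrightarrow>
     f 1 = 1 \<and> (\<forall>x y. f (x + y) = f x + f y) \<and> (\<forall>x y. f (x * y) = f x * f y)"

definition is_ring_automorphism :: "('r::ring_1 \<Rightarrow> 'r) \<Rightarrow> bool" where
  "is_ring_automorphism f \<longleftrightarrow> is_ring_hom f \<and> bij f"

definition is_ring_antiautomorphism :: "('r::ring_1 \<Rightarrow> 'r) \<Rightarrow> bool" where
  "is_ring_antiautomorphism f \<longleftrightarrow>
     f 1 = 1 \<and> (\<forall>x y. f (x + y) = f x + f y) \<and> (\<forall>x y. f (x * y) = f y * f x) \<and> bij f"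

definition is_unit_of :: "'r::ring_1 \<Rightarrow> bool" where
  "is_unit_of x \<longleftrightarrow> (\<exists>y. x * y = 1 \<and> y * x = 1)"

definition unit_inv :: "'r::ring_1 \<Rightarrow> 'r" where
  "unit_inv x = (THE y. x * y = 1 \<and> y * x = 1)"

definition Ad :: "'r::ring_1 \<Rightarrow> 'r \<Rightarrow> 'r" where
  "Ad X \<phi> = X * \<phi> * unit_inv X"

definition comm :: "'r::ring_1 \<Rightarrow> 'r \<Rightarrow> 'r" where
  "comm x y = x * y - y * x"


section \<open>The Cartan matrix of type \<open>D\<^sub>5\<^sup>(\<^sup>1\<^sup>)\<close>\<close>

definition joined :: "nat \<Rightarrow> nat \<Rightarrow> bool" where
  "joined i j \<longleftrightarrow>
     {i, j} \<in> {{0, 2}, {1, 2}, {2, 3}, {3, 4}, {3, 5}}"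

definition cartan :: "nat \<Rightarrow> nat \<Rightarrow> int" where
  "cartan i j = (if i = j then 2 else if joined i j then - 1 else 0)"


section \<open>The skew field\<close>

text \<open>
  The type \<open>'f\<close> carries the skew field \<open>F\<close>; the type \<open>'b\<close> carries an overring that also
  contains the letters \<open>\<alpha>\<^sub>j\<close>, \<open>\<partial>\<^sub>j\<close>, \<open>\<partial>'\<^sub>j\<close>. Indices run through \<open>0, \<dots>, 5\<close>; the values of
  the indexed data at larger indices are irrelevant.
\<close>

record ('f, 'b) qdata =
  sc :: "complex \<Rightarrow> 'f"
  qq :: 'f
  aa :: "nat \<Rightarrow> 'f"
  FF :: 'f
  GG :: 'f
  emb :: "'f \<Rightarrow> 'b"
  al :: "nat \<Rightarrow> 'b"
  dd :: "nat \<Rightarrow> 'b"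
  dd' :: "nat \<Rightarrow> 'b"

definition central :: "'f::ring_1 \<Rightarrow> bool" where
  "central x \<longleftrightarrow> (\<forall>y. x * y = y * x)"

definition lin_indep_over_C :: "(complex \<Rightarrow> 'f::ring_1) \<Rightarrow> ('i \<Rightarrow> 'f) \<Rightarrow> 'i set \<Rightarrow> bool" where
  "lin_indep_over_C s e I \<longleftrightarrow>
     (\<forall>S c. finite S \<and> S \<subseteq> I \<and> (\<Sum>i\<in>S. s (c i) * e i) = 0 \<longrightarrow> (\<forall>i\<in>S. c i = 0))"

definition mono_a :: "('f::division_ring, 'b) qdata \<Rightarrow> (nat \<Rightarrow> int) \<Rightarrow> 'f" where
  "mono_a Q n = prod_list (map (\<lambda>k. aa Q k powi n k) [0..<6])"

definition mono_qaFG :: "('f::division_ring, 'b) qdata \<Rightarrow> nat \<times> (nat \<Rightarrow> int) \<times> nat \<times> nat \<Rightarrow> 'f" where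
  "mono_qaFG Q = (\<lambda>(m, \<mu>, i, j). qq Q ^ m * mono_a Q \<mu> * FF Q ^ i * GG Q ^ j)"

definition exponents :: "(nat \<Rightarrow> int) set" where
  "exponents = {\<mu>. (\<forall>k<6. \<mu> k \<ge> 0) \<and> (\<forall>k\<ge>6. \<mu> k = 0)}"

definition q_formal :: "('f::division_ring, 'b) qdata \<Rightarrow> bool" where
  "q_formal Q \<longleftrightarrow> lin_indep_over_C (sc Q) (mono_qaFG Q) (UNIV \<times> exponents \<times> UNIV \<times> UNIV)"

definition q_numeric :: "('f::division_ring, 'b) qdata \<Rightarrow> bool" where
  "q_numeric Q \<longleftrightarrow>
     (\<exists>z. qq Q = sc Q z \<and> 0 < cmod z \<and> cmod z < 1) \<and>
     lin_indep_over_C (sc Q) (mono_qaFG Q) ({0} \<times> exponents \<times> UNIV \<times> UNIV)"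

text \<open>The algebra generated by \<open>F\<close> and \<open>G\<close> over \<open>\<complex>[q, a\<^sub>0, \<dots>, a\<^sub>5]\<close>. It has the same skew field of
  fractions as the algebra generated over \<open>\<complex>(a\<^sub>0, \<dots>, a\<^sub>5)\<close>, since central denominators cancel.\<close>

inductive_set FG_algebra :: "('f::division_ring, 'b) qdata \<Rightarrow> 'f set" for Q where
  "sc Q c \<in> FG_algebra Q"
| "qq Q \<in> FG_algebra Q"
| "k < 6 \<Longrightarrow> aa Q k \<in> FG_algebra Q"
| "FF Q \<in> FG_algebra Q"
| "GG Q \<in> FG_algebra Q"
| "x \<in> FG_algebra Q \<Longrightarrow> y \<in> FG_algebra Q \<Longrightarrow> x + y \<in> FG_algebra Q"
| "x \<in> FG_algebra Q \<Longrightarrow> y \<in> FG_algebra Q \<Longrightarrow> x * y \<in> FG_algebra Q"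

text \<open>The next predicate determines the skew field up to isomorphism: the relations leave the
  ordered monomials in \<open>q, a\<^sub>0, \<dots>, a\<^sub>5, F, G\<close> as a spanning set of the algebra, and \<open>q_formal\<close> or
  \<open>q_numeric\<close> makes them a basis. The value \<open>q = 0\<close> has to be excluded because \<open>F G \<noteq> 0\<close>.\<close>

definition quantum_skew_field :: "('f::division_ring, 'b) qdata \<Rightarrow> bool" where
  "quantum_skew_field Q \<longleftrightarrow>
     is_ring_hom (sc Q) \<and>
     (\<forall>c. central (sc Q c)) \<and> central (qq Q) \<and> (\<forall>k<6. central (aa Q k)) \<and>
     FF Q * GG Q = qq Q * GG Q * FF Q \<and>
     (q_formal Q \<or> q_numeric Q) \<and>
     (\<forall>\<phi>. \<exists>A\<in>FG_algebra Q. \<exists>B\<in>FG_algebra Q. B \<noteq> 0 \<and> \<phi> = A / B)"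


section \<open>The Weyl group action and the antiautomorphisms\<close>

definition weyl_action :: "('f::division_ring, 'b) qdata \<Rightarrow> (nat \<Rightarrow> 'f \<Rightarrow> 'f) \<Rightarrow> bool" where
  "weyl_action Q s \<longleftrightarrow>
     (\<forall>i<6. is_ring_automorphism (s i)) \<and>
     (\<forall>i<6. \<forall>c. s i (sc Q c) = sc Q c) \<and> (\<forall>i<6. s i (qq Q) = qq Q) \<and>
     (\<forall>i<6. \<forall>j<6. s i (aa Q j) = aa Q i powi (- cartan i j) * aa Q j) \<and>
     s 2 (FF Q) = FF Q *
       ((aa Q 0 * inverse (aa Q 1) * GG Q + aa Q 2 ^ 2) /
        (aa Q 0 * inverse (aa Q 1) * aa Q 2 ^ 2 * GG Q + 1)) \<and>
     (\<forall>j<6. j \<noteq> 2 \<longrightarrow> s j (FF Q) = FF Q) \<and>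
     s 3 (GG Q) =
       ((aa Q 3 ^ 2 * aa Q 4 * inverse (aa Q 5) * FF Q + 1) /
        (aa Q 4 * inverse (aa Q 5) * FF Q + aa Q 3 ^ 2)) * GG Q \<and>
     (\<forall>j<6. j \<noteq> 3 \<longrightarrow> s j (GG Q) = GG Q)"

definition is_sigma01 :: "('f::division_ring, 'b) qdata \<Rightarrow> ('f \<Rightarrow> 'f) \<Rightarrow> bool" where
  "is_sigma01 Q f \<longleftrightarrow>
     is_ring_antiautomorphism f \<and> (\<forall>c. f (sc Q c) = sc Q c) \<and> f (qq Q) = qq Q \<and>
     f (aa Q 0) = inverse (aa Q 1) \<and> f (aa Q 1) = inverse (aa Q 0) \<and>
     (\<forall>j<6. j \<noteq> 0 \<and> j \<noteq> 1 \<longrightarrow> f (aa Q j) = inverse (aa Q j)) \<and>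
     f (FF Q) = inverse (qq Q) * inverse (FF Q) \<and> f (GG Q) = GG Q"

definition is_sigma45 :: "('f::division_ring, 'b) qdata \<Rightarrow> ('f \<Rightarrow> 'f) \<Rightarrow> bool" where
  "is_sigma45 Q f \<longleftrightarrow>
     is_ring_antiautomorphism f \<and> (\<forall>c. f (sc Q c) = sc Q c) \<and> f (qq Q) = qq Q \<and>
     f (aa Q 4) = inverse (aa Q 5) \<and> f (aa Q 5) = inverse (aa Q 4) \<and>
     (\<forall>j<6. j \<noteq> 4 \<and> j \<noteq> 5 \<longrightarrow> f (aa Q j) = inverse (aa Q j)) \<and>
     f (FF Q) = FF Q \<and> f (GG Q) = inverse (qq Q) * inverse (GG Q)"

definition T3 :: "(nat \<Rightarrow> 'f \<Rightarrow> 'f) \<Rightarrow> ('f \<Rightarrow> 'f) \<Rightarrow> ('f \<Rightarrow> 'f) \<Rightarrow> 'f \<Rightarrow> 'f" where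
  "T3 s \<sigma>01 \<sigma>45 =
     s 2 \<circ> s 1 \<circ> s 0 \<circ> s 2 \<circ> s 3 \<circ> s 4 \<circ> s 5 \<circ> s 3 \<circ> (\<sigma>01 \<circ> \<sigma>45)"


section \<open>The letters and their exponentials\<close>

definition letters :: "('f::division_ring, 'b::ring_1) qdata \<Rightarrow> bool" where
  "letters Q \<longleftrightarrow>
     is_ring_hom (emb Q) \<and>
     (\<forall>j<6. \<forall>k<6. comm (al Q j) (al Q k) = 0) \<and>
     (\<forall>j<6. \<forall>\<phi>. comm (al Q j) (emb Q \<phi>) = 0) \<and>
     (\<forall>j<6. \<forall>d\<in>{dd Q j, dd' Q j}.
        (\<forall>c. comm d (emb Q (sc Q c)) = 0) \<and> comm d (emb Q (qq Q)) = 0 \<and>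
        comm d (emb Q (FF Q)) = 0 \<and> comm d (emb Q (GG Q)) = 0) \<and>
     (\<forall>j<6. \<forall>k<6. comm (dd Q j) (al Q k) = of_int (cartan j k)) \<and>
     (\<forall>j<6. \<forall>k<6. comm (dd Q j) (emb Q (aa Q k)) = of_int (cartan j k) * emb Q (aa Q k)) \<and>
     (\<forall>j<6. \<forall>k<6. comm (dd' Q j) (al Q k) = of_bool (j = k)) \<and>
     (\<forall>j<6. \<forall>k<6. comm (dd' Q j) (emb Q (aa Q k)) = of_bool (j = k) * emb Q (aa Q k))"

text \<open>
  \<open>is_exp Q D E\<close>: the unit \<open>E\<close> is the exponential \<open>e\<^sup>D\<close> of a vector field \<open>D\<close>, linear in the
  \<open>\<alpha>\<^sub>k\<close>. Since \<open>Ad (e\<^sup>D) = exp (ad D)\<close>, conjugation by \<open>E\<close> sends \<open>\<alpha>\<^sub>k\<close> to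
  \<open>\<lambda> = (\<Sum>m. (ad D)\<^sup>m \<alpha>\<^sub>k / m!)\<close>, where \<open>u m l\<close> is the coefficient of \<open>\<alpha>\<^sub>l\<close> in \<open>(ad D)\<^sup>m \<alpha>\<^sub>k\<close>, so that
  the series converges in the finite-dimensional span of the \<open>\<alpha>\<^sub>l\<close>; and it sends \<open>a\<^sub>k = exp \<alpha>\<^sub>k\<close>
  to \<open>exp \<lambda>\<close>, which is a Laurent monomial in the \<open>a\<^sub>l\<close> because \<open>\<lambda>\<close> is integral.
\<close>

definition is_exp :: "('f::division_ring, 'b::ring_1) qdata \<Rightarrow> 'b \<Rightarrow> 'b \<Rightarrow> bool" where
  "is_exp Q D E \<longleftrightarrow>
     is_unit_of E \<and>
     (\<forall>\<phi>. comm D (emb Q \<phi>) = 0 \<longrightarrow> comm E (emb Q \<phi>) = 0) \<and>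
     (\<forall>k<6. \<exists>(u :: nat \<Rightarrow> nat \<Rightarrow> complex) (n :: nat \<Rightarrow> int).
        (\<forall>m. (comm D ^^ m) (al Q k) = (\<Sum>l<6. emb Q (sc Q (u m l)) * al Q l)) \<and>
        (\<forall>l<6. (\<lambda>m. u m l / fact m) sums of_int (n l)) \<and>
        Ad E (al Q k) = (\<Sum>l<6. of_int (n l) * al Q l) \<and>
        Ad E (emb Q (aa Q k)) = emb Q (mono_a Q n))"

definition D_rho :: "('f::division_ring, 'b::ring_1) qdata \<Rightarrow> nat \<Rightarrow> 'b" where
  "D_rho Q j = emb Q (sc Q (complex_of_real (pi / 2) * \<i>)) * al Q j * dd Q j"

text \<open>The exponents in the last factors of \<open>\<Sigma>\<close>. The minus signs are essential: since
  \<open>\<sigma> = \<sigma>\<^sub>0\<^sub>1 \<sigma>\<^sub>4\<^sub>5\<close> interchanges \<open>a\<^sub>0, a\<^sub>1\<close> and \<open>a\<^sub>4, a\<^sub>5\<close> and fixes \<open>a\<^sub>2, a\<^sub>3\<close>, the parameter part of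
  \<open>\<Sigma>\<close> has to act by \<open>\<alpha>\<^sub>0 \<leftrightarrow> \<alpha>\<^sub>1\<close>, \<open>\<alpha>\<^sub>4 \<leftrightarrow> \<alpha>\<^sub>5\<close>. The printed exponents
  \<open>(\<pi>i/2)(\<alpha>\<^sub>0 + \<alpha>\<^sub>1)(\<partial>'\<^sub>0 + \<partial>'\<^sub>1)\<close>, \<open>\<pi>i \<alpha>\<^sub>2 \<partial>'\<^sub>2\<close>, \<open>\<pi>i \<alpha>\<^sub>3 \<partial>'\<^sub>3\<close>, \<open>(\<pi>i/2)(\<alpha>\<^sub>4 + \<alpha>\<^sub>5)(\<partial>'\<^sub>4 + \<partial>'\<^sub>5)\<close> give
  instead the composite of this interchange with \<open>a\<^sub>j \<mapsto> a\<^sub>j\<^sup>-\<^sup>1\<close> for all \<open>j\<close>.\<close>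

definition D_swap :: "('f::division_ring, 'b::ring_1) qdata \<Rightarrow> nat \<Rightarrow> nat \<Rightarrow> 'b" where
  "D_swap Q i j =
     emb Q (sc Q (complex_of_real (pi / 2) * \<i>)) * (al Q i - al Q j) * (dd' Q i - dd' Q j)"


section \<open>Convergence\<close>

text \<open>
  Scalars are the elements of \<open>\<complex>[q]\<close>, with the \<open>q\<close>-adic topology if \<open>q\<close> is a formal letter;
  if \<open>q\<close> is a complex number they are the complex numbers with their usual topology.
\<close>

definition q_poly :: "('f::division_ring, 'b) qdata \<Rightarrow> complex poly \<Rightarrow> 'f" where
  "q_poly Q p = (\<Sum>i\<le>degree p. sc Q (coeff p i) * qq Q ^ i)"

definition scalar_lim :: "('f::division_ring, 'b) qdata \<Rightarrow> (nat \<Rightarrow> 'f) \<Rightarrow> 'f \<Rightarrow> bool" where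
  "scalar_lim Q c l \<longleftrightarrow>
     (if qq Q \<in> range (sc Q)
      then \<exists>x y. (\<forall>N. c N = sc Q (x N)) \<and> l = sc Q y \<and> x \<longlonglongrightarrow> y
      else \<exists>p r. (\<forall>N. c N = q_poly Q (p N)) \<and> l = q_poly Q r \<and>
             (\<forall>M. \<forall>\<^sub>F N in sequentially. monom 1 M dvd (p N - r)))"

text \<open>
  No ring containing the skew field is complete for a \<open>q\<close>-adic valuation, because
  \<open>q = F G F\<^sup>-\<^sup>1 G\<^sup>-\<^sup>1\<close> is a commutator. A sequence of fractions converges if numerators and
  denominators converge coefficientwise in a fixed finite-dimensional space, the limit of the
  denominators being nonzero.
\<close>

definition q_lim :: "('f::division_ring, 'b) qdata \<Rightarrow> (nat \<Rightarrow> 'f) \<Rightarrow> 'f \<Rightarrow> bool" where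
  "q_lim Q w l \<longleftrightarrow>
     (\<exists>(r::nat) (e :: nat \<Rightarrow> 'f) (c :: nat \<Rightarrow> nat \<Rightarrow> 'f) (d :: nat \<Rightarrow> nat \<Rightarrow> 'f) c' d'.
        (\<forall>i<r. scalar_lim Q (c i) (c' i) \<and> scalar_lim Q (d i) (d' i)) \<and>
        (\<forall>\<^sub>F N in sequentially.
           (\<Sum>i<r. d i N * e i) \<noteq> 0 \<and> w N = (\<Sum>i<r. c i N * e i) / (\<Sum>i<r. d i N * e i)) \<and>
        (\<Sum>i<r. d' i * e i) \<noteq> 0 \<and> l = (\<Sum>i<r. c' i * e i) / (\<Sum>i<r. d' i * e i))"

text \<open>
  An infinite product is represented by the sequence of its partial products, and products of
  such sequences (and of constant elements) are formed termwise. For a sequence \<open>X\<close> of units,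
  \<open>Ad_lim Q X \<phi> \<psi>\<close> means that \<open>X N * \<phi> * (X N)\<^sup>-\<^sup>1\<close> lies in the skew field for all \<open>N\<close> and tends
  to \<open>\<psi>\<close>.
\<close>

definition Ad_lim :: "('f::division_ring, 'b::ring_1) qdata \<Rightarrow> (nat \<Rightarrow> 'b) \<Rightarrow> 'f \<Rightarrow> 'f \<Rightarrow> bool" where
  "Ad_lim Q X \<phi> \<psi> \<longleftrightarrow>
     (\<forall>N. is_unit_of (X N)) \<and>
     (\<exists>w. (\<forall>N. Ad (X N) (emb Q \<phi>) = emb Q (w N)) \<and> q_lim Q w \<psi>)"


section \<open>Infinite products and the Hamiltonian\<close>

definition qpoch :: "('f::division_ring, 'b) qdata \<Rightarrow> 'f \<Rightarrow> nat \<Rightarrow> 'f" where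
  "qpoch Q x N = prod_list (map (\<lambda>m. 1 + x * qq Q ^ m) [0..<N])"

definition theta :: "('f::division_ring, 'b) qdata \<Rightarrow> 'f \<Rightarrow> nat \<Rightarrow> 'f" where
  "theta Q X N = qpoch Q X N * qpoch Q (qq Q * inverse X) N"

definition Psi :: "('f::division_ring, 'b) qdata \<Rightarrow> 'f \<Rightarrow> 'f \<Rightarrow> nat \<Rightarrow> 'f" where
  "Psi Q z X N =
     (qpoch Q (qq Q * X) N * qpoch Q (inverse X) N) /
     (qpoch Q (z * qq Q * X) N * qpoch Q (z * inverse X) N)"

text \<open>The argument of \<open>\<Psi>\<close> in \<open>S\<^sub>3\<close> is \<open>a\<^sub>4 a\<^sub>5\<^sup>-\<^sup>1 F\<close> and not, as printed, \<open>a\<^sub>5 a\<^sub>4\<^sup>-\<^sup>1 F\<close>: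
  \<open>\<Psi>(z, q X) / \<Psi>(z, X) = (1 + z q X) / (q X + z)\<close> gives
  \<open>Ad(\<Psi>(z, c F))(G) = (z c F + 1) / (c F + z) * G\<close>, which is \<open>s\<^sub>3(G)\<close> for \<open>z = a\<^sub>3\<^sup>2\<close> and
  \<open>c = a\<^sub>4 a\<^sub>5\<^sup>-\<^sup>1\<close>.\<close>

definition SS :: "('f::division_ring, 'b::ring_1) qdata \<Rightarrow> (nat \<Rightarrow> 'b) \<Rightarrow> nat \<Rightarrow> nat \<Rightarrow> 'b" where
  "SS Q \<rho> j N =
     (if j = 2 then emb Q (Psi Q (aa Q 2 ^ 2) (aa Q 0 * inverse (aa Q 1) * GG Q) N) * \<rho> 2
      else if j = 3 then emb Q (Psi Q (aa Q 3 ^ 2) (aa Q 4 * inverse (aa Q 5) * FF Q) N) * \<rho> 3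
      else \<rho> j)"

definition Sig :: "('f::division_ring, 'b::ring_1) qdata \<Rightarrow> 'b \<Rightarrow> 'b \<Rightarrow> nat \<Rightarrow> 'b" where
  "Sig Q \<epsilon>01 \<epsilon>45 N =
     emb Q (theta Q (qq Q * FF Q * GG Q) N * theta Q (inverse (GG Q) * FF Q) N *
            theta Q (qq Q * FF Q) N ^ 4) * \<epsilon>01 * \<epsilon>45"

end

theory Submission
  imports Defs
begin

text \<open>
  Conjugation by the products truncated at \<open>N\<close> maps the skew field into itself. The functional
  equations of the factors show that the images of \<open>F\<close> and \<open>G\<close> are rational expressions in the
  central element \<open>u = q\<^sup>N\<close> that are regular at \<open>u = 0\<close>. By the Ore property of polynomials in \<open>u\<close>, the
  sequences of this kind are closed under the field operations, and they tend to their value at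
  \<open>u = 0\<close>. So it suffices to compare that value with \<open>T\<^sub>3\<close> on the generators. For \<open>S\<^sub>2\<close> and
  \<open>S\<^sub>3\<close> this is the functional equation of \<open>\<Psi>\<close>; for \<open>\<Sigma>\<close> it is
  \<open>\<theta>(q X) = X\<^sup>-\<^sup>1 \<theta>(X)\<close>, applied to the three theta factors in turn.
\<close>

text \<open>Two obstacles shape the argument. Limits in the sense of \<open>q_lim\<close> are
  awkward to combine: numerator and denominator must be expanded over fixed vectors, and sums and
  products of fractions in a skew field do not obviously keep that form. So the stronger notion
  \<open>qfrac\<close> is carried throughout and converted to \<open>q_lim\<close> only at the end.
  The second obstacle is composition. In the conjugation by \<open>X N * Y N\<close>, the map
  belonging to \<open>X N\<close> is applied to an element that itself depends on \<open>N\<close>,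
  so pointwise convergence of both maps does not suffice. It does suffice for sequences rational in
  \<open>q ^ N\<close>: such a sequence involves finitely many fixed coefficients, and the maps fix
  \<open>q\<close>. The formal and the numerical \<open>q\<close> need no separate treatment before
  the conversion: centrality and distinctness of the powers of \<open>q\<close> are all that the
  calculus uses. The fourth power in \<open>Sig\<close> has a simple origin. The first two theta
  factors send \<open>F\<close> to \<open>inverse (q * F)\<close> but \<open>inverse G\<close> to
  \<open>q * F ^ 4 * G\<close>; each of the four factors \<open>theta(q F)\<close> then removes one
  \<open>F\<close>.\<close>

lemma is_ring_homD:
  assumes "is_ring_hom f"
  shows "f 1 = 1" "f (x + y) = f x + f y" "f (x * y) = f x * f y" "f 0 = 0" "f (- x) = - f x"
    "f (x - y) = f x - f y"
proof -
  show 1: "f 1 = 1" "f (x + y) = f x + f y" "f (x * y) = f x * f y" for x y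
    using assms by (auto simp: is_ring_hom_def)
  have "f 0 + f 0 = f 0 + 0"
    by (simp flip: 1(2))
  then show 0: "f 0 = 0"
    by (simp only: add_left_cancel)
  have "f (- x) + f x = 0" for x
    by (simp flip: 1(2) add: 0)
  then show m: "f (- x) = - f x" for x
    by (simp add: eq_neg_iff_add_eq_0)
  show "f (x - y) = f x - f y"
    using 1(2)[of x "- y"] m by simp
qed

lemma is_ring_hom_nonzero:
  fixes f :: "'f::division_ring \<Rightarrow> 's::ring_1"
  assumes "is_ring_hom f" "x \<noteq> 0"
  shows "f x \<noteq> 0"
proof
  assume "f x = 0"
  then have "f (x * inverse x) = 0"
    by (simp add: is_ring_homD[OF assms(1)])
  with assms show False
    by (simp add: is_ring_homD)
qed

lemma is_ring_hom_inj:
  fixes f :: "'f::division_ring \<Rightarrow> 's::ring_1"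
  assumes "is_ring_hom f" "f x = f y"
  shows "x = y"
  using is_ring_hom_nonzero[OF assms(1), of "x - y"] assms by (auto simp: is_ring_homD)

lemma is_ring_hom_inverse:
  fixes f :: "'f::division_ring \<Rightarrow> 's::division_ring"
  assumes "is_ring_hom f"
  shows "f (inverse x) = inverse (f x)"
proof (cases "x = 0")
  case False
  then have "f x * f (inverse x) = 1"
    by (simp flip: is_ring_homD(3)[OF assms] add: is_ring_homD(1)[OF assms])
  then show ?thesis
    by (metis inverse_unique)
qed (simp add: is_ring_homD[OF assms])

lemma is_ring_hom_power: "is_ring_hom f \<Longrightarrow> f (x ^ n) = f x ^ n"
  by (induction n) (auto simp: is_ring_homD)

lemma is_ring_hom_comp: "is_ring_hom f \<Longrightarrow> is_ring_hom g \<Longrightarrow> is_ring_hom (f \<circ> g)"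
  by (simp add: is_ring_hom_def)

lemma is_ring_hom_id: "is_ring_hom (\<lambda>x. x)"
  by (auto simp: is_ring_hom_def)

lemma is_ring_hom_comp_antiauto:
  assumes "is_ring_antiautomorphism f" "is_ring_antiautomorphism g"
  shows "is_ring_hom (f \<circ> g)"
  using assms by (auto simp: is_ring_hom_def is_ring_antiautomorphism_def)

lemma antiauto_inverse:
  fixes f :: "'f::division_ring \<Rightarrow> 'f"
  assumes "is_ring_antiautomorphism f" "x \<noteq> 0"
  shows "f (inverse x) = inverse (f x)"
proof -
  have "f (inverse x * x) = f x * f (inverse x)"
    using assms(1) by (simp add: is_ring_antiautomorphism_def)
  with assms show ?thesis
    by (metis inverse_unique is_ring_antiautomorphism_def left_inverse)
qed

section \<open>Units and conjugation in an arbitrary ring\<close>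

lemma unit_inv_eq: "x * y = 1 \<Longrightarrow> y * x = 1 \<Longrightarrow> unit_inv x = y"
  unfolding unit_inv_def by (rule the_equality) (auto, metis mult.assoc mult_1_left mult_1_right)

lemma unit_inv:
  assumes "is_unit_of x"
  shows "x * unit_inv x = 1" "unit_inv x * x = 1" "x * (unit_inv x * y) = y" "unit_inv x * (x * y) = y"
proof -
  from assms obtain z where "x * z = 1" "z * x = 1"
    by (auto simp: is_unit_of_def)
  then have *: "x * unit_inv x = 1" "unit_inv x * x = 1"
    by (simp_all add: unit_inv_eq)
  then show "x * unit_inv x = 1" "unit_inv x * x = 1" .
  show "x * (unit_inv x * y) = y" "unit_inv x * (x * y) = y"
    by (simp_all add: * flip: mult.assoc)
qed

lemma is_unit_of_mult:
  assumes "is_unit_of x" "is_unit_of y"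
  shows "is_unit_of (x * y)" "unit_inv (x * y) = unit_inv y * unit_inv x"
proof -
  have *: "x * y * (unit_inv y * unit_inv x) = 1" "unit_inv y * unit_inv x * (x * y) = 1"
    using assms by (simp_all add: unit_inv mult.assoc)
  then show "is_unit_of (x * y)"
    by (auto simp: is_unit_of_def)
  from * show "unit_inv (x * y) = unit_inv y * unit_inv x"
    by (rule unit_inv_eq)
qed

lemma Ad_mult: "is_unit_of x \<Longrightarrow> is_unit_of y \<Longrightarrow> Ad (x * y) z = Ad x (Ad y z)"
  by (simp add: Ad_def is_unit_of_mult mult.assoc)

lemma is_ring_hom_Ad: "is_unit_of x \<Longrightarrow> is_ring_hom (Ad x)"
  by (simp add: is_ring_hom_def Ad_def unit_inv distrib_left distrib_right mult.assoc)

lemma Ad_commute: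
  assumes "is_unit_of x" "x * y = y * x"
  shows "Ad x y = y"
  using assms by (simp add: Ad_def unit_inv mult.assoc)

lemma is_unit_of_division: "is_unit_of x \<longleftrightarrow> x \<noteq> 0" for x :: "'f::division_ring"
  unfolding is_unit_of_def by (metis left_inverse mult_zero_left right_inverse zero_neq_one)

lemma unit_inv_division: "x \<noteq> 0 \<Longrightarrow> unit_inv x = inverse x" for x :: "'f::division_ring"
  by (rule unit_inv_eq) auto


section \<open>Rational functions of a central element, evaluated at its powers\<close>

text \<open>Distinct powers supply infinitely many evaluation points for the central variable, so
  that a polynomial vanishing at infinitely many of them is zero.\<close>

locale generic_q =
  fixes q :: "'f::division_ring"
  assumes central_q: "central q"
    and inj_powers: "inj (\<lambda>N::nat. q ^ N)"
begin

lemma q_commute: "q * x = x * q"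
  using central_q by (simp add: central_def)

lemma q_power_commute: "q ^ n * x = x * q ^ n"
proof (induction n)
  case (Suc n)
  then show ?case
    by (metis mult.assoc power_Suc q_commute)
qed simp

lemma q_power_left_commute: "x * (q ^ n * y) = q ^ n * (x * y)"
  by (metis mult.assoc q_power_commute)

lemma q_left_commute: "x * (q * y) = q * (x * y)"
  by (metis mult.assoc q_commute)

lemma q_nonzero: "q \<noteq> 0"
  using injD[OF inj_powers, of 1 2] by auto

lemma q_neq_1: "q \<noteq> 1"
  using injD[OF inj_powers, of 0 1] by auto

text \<open>\<open>qpol n w a\<close>: \<open>w N\<close> is the value at \<open>q\<^sup>N\<close> of a polynomial in a central variable that has
  degree less than \<open>n\<close> and constant coefficient \<open>a\<close>.\<close>

inductive qpol :: "nat \<Rightarrow> (nat \<Rightarrow> 'f) \<Rightarrow> 'f \<Rightarrow> bool" where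
  qpol_0: "qpol 0 (\<lambda>N. 0) 0"
| qpol_Suc: "qpol n w c \<Longrightarrow> qpol (Suc n) (\<lambda>N. a + q ^ N * w N) a"

lemma qpol_0D: "qpol 0 w a \<Longrightarrow> w = (\<lambda>N. 0) \<and> a = 0"
  by (erule qpol.cases) auto

lemma qpol_SucE:
  assumes "qpol (Suc n) w a"
  obtains v c where "qpol n v c" "w = (\<lambda>N. a + q ^ N * v N)"
  using assms by (cases rule: qpol.cases) auto

lemma qpol_shift: "qpol n w a \<Longrightarrow> qpol (Suc n) (\<lambda>N. q ^ N * w N) 0"
  using qpol_Suc[of n w a 0] by simp

lemma qpol_const: "qpol (Suc 0) (\<lambda>N. a) a"
  using qpol_Suc[OF qpol_0, of a] by simp

lemma qpol_le_Suc: "qpol n w a \<Longrightarrow> qpol (Suc n) w a"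
proof (induction rule: qpol.induct)
  case qpol_0
  then show ?case
    using qpol_const[of 0] by simp
qed (rule qpol_Suc)

lemma qpol_le:
  assumes "n \<le> m" "qpol n w a"
  shows "qpol m w a"
  using assms by (induction rule: dec_induct) (auto intro: qpol_le_Suc)

lemma qpol_add: "qpol n w a \<Longrightarrow> qpol n v b \<Longrightarrow> qpol n (\<lambda>N. w N + v N) (a + b)"
proof (induction arbitrary: v b rule: qpol.induct)
  case qpol_0
  then show ?case
    using qpol_0D[of v b] by simp
next
  case (qpol_Suc n w c a)
  from \<open>qpol (Suc n) v b\<close> obtain v' d where v': "qpol n v' d" "v = (\<lambda>N. b + q ^ N * v' N)"
    by (rule qpol_SucE)
  have "qpol (Suc n) (\<lambda>N. (a + b) + q ^ N * (w N + v' N)) (a + b)"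
    using qpol_Suc.IH[OF v'(1)] by (rule qpol.qpol_Suc)
  then show ?case
    by (simp add: v'(2) distrib_left add_ac)
qed

lemma qpol_lmult: "qpol n w a \<Longrightarrow> qpol n (\<lambda>N. c * w N) (c * a)"
proof (induction rule: qpol.induct)
  case qpol_0
  then show ?case by (simp add: qpol.qpol_0)
next
  case (qpol_Suc n w d a)
  from qpol.qpol_Suc[OF qpol_Suc.IH, of "c * a"] show ?case
    by (simp add: distrib_left q_power_left_commute)
qed

lemma qpol_rmult: "qpol n w a \<Longrightarrow> qpol n (\<lambda>N. w N * c) (a * c)"
proof (induction rule: qpol.induct)
  case qpol_0
  then show ?case by (simp add: qpol.qpol_0)
next
  case (qpol_Suc n w d a)
  from qpol.qpol_Suc[OF qpol_Suc.IH, of "a * c"] show ?case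
    by (simp add: distrib_right mult.assoc)
qed

lemma qpol_diff: "qpol n w a \<Longrightarrow> qpol n v b \<Longrightarrow> qpol n (\<lambda>N. w N - v N) (a - b)"
  using qpol_add[of n w a "\<lambda>N. - 1 * v N" "- 1 * b"] qpol_lmult[of n v b "- 1"] by simp

definition qpoly :: "(nat \<Rightarrow> 'f) \<Rightarrow> 'f \<Rightarrow> bool" where
  "qpoly w a \<longleftrightarrow> (\<exists>n. qpol n w a)"

lemma qpoly_const: "qpoly (\<lambda>N. a) a"
  unfolding qpoly_def using qpol_const by blast

lemma qpoly_shift: "qpoly w a \<Longrightarrow> qpoly (\<lambda>N. q ^ N * w N) 0"
  unfolding qpoly_def using qpol_shift by blast

lemma qpoly_add:
  assumes "qpoly w a" "qpoly v b"
  shows "qpoly (\<lambda>N. w N + v N) (a + b)"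
proof -
  from assms obtain n m where "qpol n w a" "qpol m v b"
    by (auto simp: qpoly_def)
  then have "qpol (max n m) w a" "qpol (max n m) v b"
    by (auto intro: qpol_le[rotated])
  then show ?thesis
    unfolding qpoly_def by (blast intro: qpol_add)
qed

lemma qpoly_lmult: "qpoly w a \<Longrightarrow> qpoly (\<lambda>N. c * w N) (c * a)"
  unfolding qpoly_def using qpol_lmult by blast

lemma qpoly_mult:
  assumes "qpoly w a" "qpoly v b"
  shows "qpoly (\<lambda>N. w N * v N) (a * b)"
proof -
  from assms(1) obtain n where "qpol n w a"
    by (auto simp: qpoly_def)
  then show ?thesis
  proof (induction rule: qpol.induct)
    case qpol_0
    then show ?case
      using qpoly_const[of 0] by simp
  next
    case (qpol_Suc n w d a)
    from qpoly_add[OF qpoly_lmult[OF assms(2)] qpoly_shift[OF qpol_Suc.IH], of a]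
    show ?case
      by (simp add: distrib_right mult.assoc)
  qed
qed

text \<open>Any two polynomials have a common right multiple. Euclidean division from the lowest
  coefficient upwards controls the constant coefficients.\<close>

lemma qpol_right_Ore:
  assumes "qpol n P p" "qpol m R r" "r \<noteq> 0"
  shows "\<exists>U V u v. qpoly U u \<and> qpoly V v \<and> v \<noteq> 0 \<and> (\<forall>N. P N * V N = R N * U N) \<and> p * v = r * u"
  using assms
proof (induction "n + m" arbitrary: n m P p R r rule: less_induct)
  case less
  \<comment> \<open>A nonzero constant coefficient excludes the zero polynomial, so the bound
    \<open>m\<close> is positive.\<close>
  obtain m' where m: "m = Suc m'"
    using less.prems(2,3) by (cases m) (auto dest: qpol_0D)
  show ?case
  proof (cases n)
    case 0
    then have "P = (\<lambda>N. 0)" "p = 0"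
      using less.prems(1) by (auto dest: qpol_0D)
    then show ?thesis
      by (intro exI[of _ "\<lambda>N. 0"] exI[of _ "\<lambda>N. 1"] exI[of _ 0] exI[of _ 1]) (auto simp: qpoly_const)
  next
    case n: (Suc n')
    show ?thesis
    proof (cases "m \<le> n")
      case True
      \<comment> \<open>With this \<open>a\<close> the difference \<open>P - R * a\<close> has no
        constant term. Dividing it by the variable lowers the bound on \<open>P\<close> and leaves
        \<open>R\<close>, hence \<open>r \<noteq> 0\<close>, untouched.\<close>
      define a where "a = inverse r * p"
      have ra: "r * a = p"
        using less.prems(3) by (simp add: a_def flip: mult.assoc)
      have "qpol (Suc n') (\<lambda>N. P N - R N * a) (p - r * a)"
        using less.prems(1,2) True by (intro qpol_diff qpol_rmult) (auto simp: n intro: qpol_le)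
      then obtain P' p' where P': "qpol n' P' p'" "(\<lambda>N. P N - R N * a) = (\<lambda>N. (p - r * a) + q ^ N * P' N)"
        by (rule qpol_SucE)
      obtain U V u v where UV: "qpoly U u" "qpoly V v" "v \<noteq> 0" "\<And>N. P' N * V N = R N * U N"
        using less.hyps[OF _ P'(1) less.prems(2,3)] by (auto simp: n)
      have "P N * V N = R N * (a * V N + q ^ N * U N)" for N
      proof -
        have "P N = R N * a + q ^ N * P' N"
          using fun_cong[OF P'(2), of N] by (simp add: ra diff_eq_eq add_ac)
        then have "P N * V N = R N * a * V N + q ^ N * (P' N * V N)"
          by (simp add: distrib_right mult.assoc)
        then show ?thesis
          by (simp add: UV(4) distrib_left mult.assoc q_power_left_commute)
      qed
      moreover have "qpoly (\<lambda>N. a * V N + q ^ N * U N) (a * v)"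
        using qpoly_add[OF qpoly_lmult[OF UV(2)] qpoly_shift[OF UV(1)], of a] by simp
      moreover have "p * v = r * (a * v)"
        by (simp add: ra flip: mult.assoc)
      ultimately show ?thesis
        using UV(2,3) by blast
    next
      case False
      show ?thesis
      \<comment> \<open>Now \<open>R\<close> has the larger bound, so it is \<open>R\<close> that
        should be reduced by \<open>P\<close>. This requires \<open>p \<noteq> 0\<close>; if
        \<open>p = 0\<close>, then \<open>P\<close> is already divisible by the variable and is
        shortened directly.\<close>
      proof (cases "p = 0")
        case True
        from less.prems(1) obtain P' p' where P': "qpol n' P' p'" "P = (\<lambda>N. p + q ^ N * P' N)"
          unfolding n by (rule qpol_SucE)
        obtain U V u v where UV: "qpoly U u" "qpoly V v" "v \<noteq> 0" "\<And>N. P' N * V N = R N * U N"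
          using less.hyps[OF _ P'(1) less.prems(2,3)] by (auto simp: n)
        have "\<forall>N. P N * V N = R N * (q ^ N * U N)"
          by (simp add: P'(2) True UV(4) mult.assoc q_power_left_commute)
        moreover have "p * v = r * 0"
          by (simp add: True)
        ultimately show ?thesis
          using UV(2,3) qpoly_shift[OF UV(1)] by blast
      next
        case p: False
        define b where "b = inverse p * r"
        have pb: "p * b = r"
          using p by (simp add: b_def flip: mult.assoc)
        have "qpol (Suc m') (\<lambda>N. R N - P N * b) (r - p * b)"
          using less.prems(1,2) False by (intro qpol_diff qpol_rmult) (auto simp: m intro: qpol_le[rotated])
        then obtain R' r' where R': "qpol m' R' r'" "(\<lambda>N. R N - P N * b) = (\<lambda>N. (r - p * b) + q ^ N * R' N)"
          by (rule qpol_SucE)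
        obtain U V u v where UV: "qpoly U u" "qpoly V v" "v \<noteq> 0" "\<And>N. R' N * V N = P N * U N"
          using less.hyps[OF _ R'(1) less.prems(1) p] by (auto simp: m)
        have "P N * (b * V N + q ^ N * U N) = R N * V N" for N
        proof -
          have "R N = P N * b + q ^ N * R' N"
            using fun_cong[OF R'(2), of N] by (simp add: pb diff_eq_eq add_ac)
          then have "R N * V N = P N * b * V N + q ^ N * (R' N * V N)"
            by (simp add: distrib_right mult.assoc)
          then show ?thesis
            by (simp add: UV(4) distrib_left mult.assoc q_power_left_commute)
        qed
        moreover have "qpoly (\<lambda>N. b * V N + q ^ N * U N) (b * v)"
          using qpoly_add[OF qpoly_lmult[OF UV(2)] qpoly_shift[OF UV(1)], of b] by simp
        moreover have "p * (b * v) = r * v"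
          by (simp add: pb flip: mult.assoc)
        \<comment> \<open>In this branch the multiplier of \<open>P\<close> is the combination built
          with \<open>b\<close>. Its constant coefficient is nonzero because \<open>b\<close> is,
          and that rests on \<open>r \<noteq> 0\<close>.\<close>
        moreover have "b * v \<noteq> 0"
          using UV(3) p less.prems(3) by (simp add: b_def)
        ultimately show ?thesis
          using UV(2) by blast
      qed
    qed
  qed
qed

lemma qpoly_right_Ore:
  assumes "qpoly P p" "qpoly R r" "r \<noteq> 0"
  obtains U V u v where "qpoly U u" "qpoly V v" "v \<noteq> 0" "\<And>N. P N * V N = R N * U N" "p * v = r * u"
proof -
  from assms(1,2) obtain n m where "qpol n P p" "qpol m R r"
    by (auto simp: qpoly_def)
  from qpol_right_Ore[OF this assms(3)] show thesis
    using that by blast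
qed

text \<open>Division by \<open>u - q ^ M\<close> in the central variable \<open>u\<close>. The last
  equation is the same identity at \<open>u = 0\<close>; it is recorded separately because the
  constant coefficient is not one of the values \<open>R N\<close>.\<close>

lemma qpol_factor_root:
  assumes "qpol n R r"
  shows "\<exists>S s. qpol (n - 1) S s \<and> (\<forall>N. R N - R M = (q ^ N - q ^ M) * S N) \<and> r = R M - q ^ M * s"
  using assms
proof (induction rule: qpol.induct)
  case qpol_0
  then show ?case
    by (intro exI[of _ "\<lambda>N. 0"] exI[of _ 0]) (auto intro: qpol.qpol_0)
next
  case (qpol_Suc n w c a)
  then obtain S s where S: "qpol (n - 1) S s" "\<And>N. w N - w M = (q ^ N - q ^ M) * S N"
    "c = w M - q ^ M * s"
    by blast
  \<comment> \<open>The quotient of \<open>u * w(u)\<close> comes from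
    \<open>u w(u) - t w(t) = (u - t) w(u) + t (w(u) - w(t))\<close> with
    \<open>t = q ^ M\<close>.\<close>
  have 1: "qpol n (\<lambda>N. w N + q ^ M * S N) (w M)"
  proof -
    have "qpol n (\<lambda>N. q ^ M * S N) (q ^ M * s)"
      using S(1) by (intro qpol_lmult qpol_le[of "n - 1" n]) auto
    from qpol_add[OF qpol_Suc.hyps this] show ?thesis
      by (simp add: S(3))
  qed
  have 2: "a + q ^ N * w N - (a + q ^ M * w M) = (q ^ N - q ^ M) * (w N + q ^ M * S N)" for N
  proof -
    have "a + q ^ N * w N - (a + q ^ M * w M) = (q ^ N - q ^ M) * w N + q ^ M * (w N - w M)"
      by (simp add: algebra_simps)
    also have "\<dots> = (q ^ N - q ^ M) * w N + q ^ M * ((q ^ N - q ^ M) * S N)"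
      by (simp add: S(2))
    also have "q ^ M * ((q ^ N - q ^ M) * S N) = (q ^ N - q ^ M) * (q ^ M * S N)"
      by (simp add: q_power_left_commute)
    finally show ?thesis
      by (simp add: distrib_left)
  qed
  show ?case
    by (rule exI[of _ "\<lambda>N. w N + q ^ M * S N"], rule exI[of _ "w M"], intro conjI allI)
      (use 1 2 in \<open>simp_all del: add_diff_cancel_left\<close>)
qed

text \<open>A zero at \<open>q ^ M\<close> splits off a factor and lowers the bound by one. Since
  the powers of \<open>q\<close> are distinct, all other zeros are inherited by the
  quotient.\<close>

lemma qpol_infinite_zeros:
  assumes "qpol n R r" "infinite {N. R N = 0}"
  shows "r = 0 \<and> (\<forall>N. R N = 0)"
  using assms
proof (induction n arbitrary: R r)
  case 0
  then show ?case
    by (auto dest: qpol_0D)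
next
  case (Suc n)
  from Suc.prems(2) obtain M where M: "R M = 0"
    using infinite_imp_nonempty by auto
  obtain S s where S: "qpol n S s" "\<And>N. R N = (q ^ N - q ^ M) * S N" "r = - (q ^ M * s)"
    using qpol_factor_root[OF Suc.prems(1), of M] by (auto simp: M)
  have "{N. R N = 0} \<subseteq> insert M {N. S N = 0}"
    using injD[OF inj_powers] by (auto simp: S(2))
  then have "infinite {N. S N = 0}"
    using Suc.prems(2) finite_subset by auto
  with Suc.IH[OF S(1)] show ?case
    by (simp add: S(2,3))
qed

lemma qpoly_eventually_nonzero:
  assumes "qpoly R r" "r \<noteq> 0"
  shows "\<forall>\<^sub>F N in sequentially. R N \<noteq> 0"
proof -
  have "finite {N. R N = 0}"
    using assms qpol_infinite_zeros unfolding qpoly_def by blast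
  then show ?thesis
    by (simp add: eventually_cofinite flip: cofinite_eq_sequentially)
qed

text \<open>\<open>qfrac w l\<close>: \<open>w N\<close> is the value at \<open>q\<^sup>N\<close> of a rational function that is regular at \<open>0\<close>
  with value \<open>l\<close> there.\<close>

definition qfrac :: "(nat \<Rightarrow> 'f) \<Rightarrow> 'f \<Rightarrow> bool" where
  "qfrac w l \<longleftrightarrow> (\<exists>P p R r. qpoly P p \<and> qpoly R r \<and> r \<noteq> 0 \<and> l = p * inverse r \<and>
     (\<forall>\<^sub>F N in sequentially. w N = P N * inverse (R N)))"

lemma qfracI:
  assumes "qpoly P p" "qpoly R r" "r \<noteq> 0" "l = p * inverse r"
    "\<forall>\<^sub>F N in sequentially. w N = P N * inverse (R N)"
  shows "qfrac w l"
  using assms unfolding qfrac_def by blast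

lemma qfracE:
  assumes "qfrac w l"
  obtains P p R r where "qpoly P p" "qpoly R r" "r \<noteq> 0" "l = p * inverse r"
    "\<forall>\<^sub>F N in sequentially. R N \<noteq> 0 \<and> w N = P N * inverse (R N)"
proof -
  from assms obtain P p R r where *: "qpoly P p" "qpoly R r" "r \<noteq> 0" "l = p * inverse r"
    "\<forall>\<^sub>F N in sequentially. w N = P N * inverse (R N)"
    unfolding qfrac_def by blast
  show thesis
    using eventually_conj[OF qpoly_eventually_nonzero[OF *(2,3)] *(5)] by (rule that[OF *(1-4)])
qed

lemma qpoly_imp_qfrac: "qpoly w a \<Longrightarrow> qfrac w a"
  by (rule qfracI[OF _ qpoly_const[of 1]]) auto

lemma qfrac_const: "qfrac (\<lambda>N. a) a"
  by (intro qpoly_imp_qfrac qpoly_const)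

lemma qfrac_power: "qfrac (\<lambda>N. q ^ N) 0"
  using qpoly_imp_qfrac[OF qpoly_shift[OF qpoly_const[of 1]]] by simp

text \<open>In \<open>P * inverse R * P' * inverse R'\<close> the inner
  \<open>inverse R * P'\<close> stands in the wrong order. The Ore property turns it into
  \<open>U * inverse V\<close>, with a \<open>V\<close> that does not vanish at \<open>0\<close>, so
  the product stays regular there.\<close>

lemma qfrac_mult:
  assumes "qfrac w a" "qfrac v b"
  shows "qfrac (\<lambda>N. w N * v N) (a * b)"
proof -
  from assms(1) obtain P p R r where 1: "qpoly P p" "qpoly R r" "r \<noteq> 0" "a = p * inverse r"
    "\<forall>\<^sub>F N in sequentially. R N \<noteq> 0 \<and> w N = P N * inverse (R N)"
    by (rule qfracE)
  from assms(2) obtain P' p' R' r' where 2: "qpoly P' p'" "qpoly R' r'" "r' \<noteq> 0" "b = p' * inverse r'"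
    "\<forall>\<^sub>F N in sequentially. R' N \<noteq> 0 \<and> v N = P' N * inverse (R' N)"
    by (rule qfracE)
  obtain U V u v' where 3: "qpoly U u" "qpoly V v'" "v' \<noteq> 0" "\<And>N. P' N * V N = R N * U N" "p' * v' = r * u"
    using qpoly_right_Ore[OF 2(1) 1(2,3)] by metis
  have swap: "inverse x * y = s * inverse t" if "x \<noteq> 0" "t \<noteq> 0" "y * t = x * s" for x y s t :: 'f
  proof -
    have "inverse x * y * t = s"
      using that by (simp add: mult.assoc) (simp flip: mult.assoc)
    then have "inverse x * y * (t * inverse t) = s * inverse t"
      by (simp flip: mult.assoc)
    with that show ?thesis by simp
  qed
  show ?thesis
  proof (rule qfracI)
    show "qpoly (\<lambda>N. P N * U N) (p * u)" "qpoly (\<lambda>N. R' N * V N) (r' * v')" "r' * v' \<noteq> 0"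
      using 1 2 3 by (auto intro: qpoly_mult)
    show "a * b = p * u * inverse (r' * v')"
      using swap[OF 1(3) 3(3) 3(5)] 2(3) 3(3)
      by (simp add: 1 2 nonzero_inverse_mult_distrib) (metis mult.assoc)
    show "\<forall>\<^sub>F N in sequentially. w N * v N = P N * U N * inverse (R' N * V N)"
      using 1(5) 2(5) qpoly_eventually_nonzero[OF 3(2,3)]
    proof eventually_elim
      case (elim N)
      then show ?case
        using swap[of "R N" "V N" "P' N" "U N"] 3(4)[of N]
        by (simp add: nonzero_inverse_mult_distrib) (metis mult.assoc)
    qed
  qed
qed

lemma qfrac_add:
  assumes "qfrac w a" "qfrac v b"
  shows "qfrac (\<lambda>N. w N + v N) (a + b)"
proof -
  from assms(1) obtain P p R r where 1: "qpoly P p" "qpoly R r" "r \<noteq> 0" "a = p * inverse r"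
    "\<forall>\<^sub>F N in sequentially. R N \<noteq> 0 \<and> w N = P N * inverse (R N)"
    by (rule qfracE)
  from assms(2) obtain P' p' R' r' where 2: "qpoly P' p'" "qpoly R' r'" "r' \<noteq> 0" "b = p' * inverse r'"
    "\<forall>\<^sub>F N in sequentially. R' N \<noteq> 0 \<and> v N = P' N * inverse (R' N)"
    by (rule qfracE)
  obtain U V u v' where 3: "qpoly U u" "qpoly V v'" "v' \<noteq> 0" "\<And>N. R' N * V N = R N * U N" "r' * v' = r * u"
    using qpoly_right_Ore[OF 2(2) 1(2,3)] by metis
  \<comment> \<open>The common denominator is \<open>R * U = R' * V\<close>. Its constant
    coefficient \<open>r * u = r' * v'\<close> is nonzero by the right-hand side, which makes
    \<open>u\<close> nonzero too.\<close>
  have u: "u \<noteq> 0"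
    using 2(3) 3(3,5) by auto
  have exp: "x * inverse y = x * z * inverse (y * z)" if "y \<noteq> 0" "z \<noteq> 0" for x y z :: 'f
  proof -
    have "x * z * inverse (y * z) = x * (z * inverse z) * inverse y"
      using that by (simp add: nonzero_inverse_mult_distrib mult.assoc del: right_inverse left_inverse)
    with that show ?thesis by simp
  qed
  show ?thesis
  proof (rule qfracI)
    show "qpoly (\<lambda>N. P N * U N + P' N * V N) (p * u + p' * v')" "qpoly (\<lambda>N. R N * U N) (r * u)" "r * u \<noteq> 0"
      using 1 2 3 u by (auto intro: qpoly_mult qpoly_add)
    show "a + b = (p * u + p' * v') * inverse (r * u)"
      using exp[OF 1(3) u, of p] exp[OF 2(3) 3(3), of p'] by (simp add: 1 2 3 distrib_right)
    show "\<forall>\<^sub>F N in sequentially. w N + v N = (P N * U N + P' N * V N) * inverse (R N * U N)"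
      using 1(5) 2(5) qpoly_eventually_nonzero[OF 3(2,3)] qpoly_eventually_nonzero[OF 3(1) u]
    proof eventually_elim
      case (elim N)
      then show ?case
        using exp[of "R N" "U N" "P N"] exp[of "R' N" "V N" "P' N"] by (simp add: 3 distrib_right)
    qed
  qed
qed

lemma qfrac_inverse:
  assumes "qfrac w a" "a \<noteq> 0"
  shows "qfrac (\<lambda>N. inverse (w N)) (inverse a)"
proof -
  from assms(1) obtain P p R r where 1: "qpoly P p" "qpoly R r" "r \<noteq> 0" "a = p * inverse r"
    "\<forall>\<^sub>F N in sequentially. R N \<noteq> 0 \<and> w N = P N * inverse (R N)"
    by (rule qfracE)
  have p: "p \<noteq> 0"
    using assms(2) 1(4) by auto
  show ?thesis
  proof (rule qfracI[OF 1(2,1) p])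
    show "inverse a = r * inverse p"
      using 1(3) p by (simp add: 1(4) nonzero_inverse_mult_distrib)
    show "\<forall>\<^sub>F N in sequentially. inverse (w N) = R N * inverse (P N)"
      using 1(5) qpoly_eventually_nonzero[OF 1(1) p]
      by eventually_elim (simp add: nonzero_inverse_mult_distrib)
  qed
qed

lemma qfrac_zero_limit:
  assumes "qfrac (\<lambda>N. 0) a"
  shows "a = 0"
proof -
  from assms obtain P p R r where 1: "qpoly P p" "qpoly R r" "r \<noteq> 0" "a = p * inverse r"
    "\<forall>\<^sub>F N in sequentially. R N \<noteq> 0 \<and> 0 = P N * inverse (R N)"
    by (rule qfracE)
  have "\<forall>\<^sub>F N in sequentially. P N = 0"
    using 1(5) by eventually_elim auto
  then have "\<not> (\<forall>\<^sub>F N in sequentially. P N \<noteq> 0)"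
    using eventually_conj by fastforce
  then have "p = 0"
    using qpoly_eventually_nonzero[OF 1(1)] by blast
  then show ?thesis
    by (simp add: 1)
qed

text \<open>Makes the value at \<open>0\<close> a function of the sequence, so that identities
  between sequences pass to their limits.\<close>

lemma qfrac_unique:
  assumes "qfrac w a" "qfrac w b"
  shows "a = b"
proof -
  have "qfrac (\<lambda>N. w N + - 1 * w N) (a + - 1 * b)"
    using assms by (intro qfrac_add qfrac_mult qfrac_const)
  then show ?thesis
    using qfrac_zero_limit by fastforce
qed

lemma qfrac_cong_eventually:
  assumes "qfrac w a" "\<forall>\<^sub>F N in sequentially. v N = w N"
  shows "qfrac v a"
proof -
  from assms(1) obtain P p R r where 1: "qpoly P p" "qpoly R r" "r \<noteq> 0" "a = p * inverse r"
    "\<forall>\<^sub>F N in sequentially. R N \<noteq> 0 \<and> w N = P N * inverse (R N)"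
    by (rule qfracE)
  show ?thesis
  proof (rule qfracI[OF 1(1-4)])
    show "\<forall>\<^sub>F N in sequentially. v N = P N * inverse (R N)"
      using 1(5) assms(2) by eventually_elim simp
  qed
qed

section \<open>Sequences of ring homomorphisms and their limits\<close>

definition conv_homs :: "(nat \<Rightarrow> 'f \<Rightarrow> 'f) \<Rightarrow> ('f \<Rightarrow> 'f) \<Rightarrow> bool" where
  "conv_homs \<tau> t \<longleftrightarrow>
     (\<forall>N. is_ring_hom (\<tau> N) \<and> \<tau> N q = q) \<and> is_ring_hom t \<and> (\<forall>x. qfrac (\<lambda>N. \<tau> N x) (t x))"

text \<open>The step that makes limits of compositions work. Because \<open>\<tau> N\<close> fixes
  \<open>q\<close>, it acts on a polynomial in \<open>q ^ N\<close> coefficient by coefficient, and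
  there are only finitely many coefficients, each independent of \<open>N\<close>. Denominators keep
  a nonzero limit since \<open>t\<close> is injective on a division ring.\<close>

lemma conv_homs_qfrac:
  assumes \<tau>: "conv_homs \<tau> t" and "qfrac w l"
  shows "qfrac (\<lambda>N. \<tau> N (w N)) (t l)"
proof -
  have hom: "is_ring_hom (\<tau> N)" "\<tau> N q = q" "is_ring_hom t" "qfrac (\<lambda>N. \<tau> N x) (t x)" for N x
    using \<tau> by (auto simp: conv_homs_def)
  have pol: "qfrac (\<lambda>N. \<tau> N (v N)) (t a)" if v: "qpoly v a" for v a
  proof -
    from v obtain n where "qpol n v a"
      by (auto simp: qpoly_def)
    then show ?thesis
    proof (induction rule: qpol.induct)
      case qpol_0
      then show ?case
        by (rule hom)
    next
      case (qpol_Suc n v d a)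
      have "qfrac (\<lambda>N. \<tau> N a + q ^ N * \<tau> N (v N)) (t a + 0 * t d)"
        by (intro qfrac_add qfrac_mult qfrac_power qpol_Suc.IH hom)
      then show ?case
        by (simp add: is_ring_homD[OF hom(1)] is_ring_hom_power[OF hom(1)] hom(2))
    qed
  qed
  from assms(2) obtain P p R r where 1: "qpoly P p" "qpoly R r" "r \<noteq> 0" "l = p * inverse r"
    "\<forall>\<^sub>F N in sequentially. R N \<noteq> 0 \<and> w N = P N * inverse (R N)"
    by (rule qfracE)
  have "qfrac (\<lambda>N. \<tau> N (P N) * inverse (\<tau> N (R N))) (t p * inverse (t r))"
    using is_ring_hom_nonzero[OF hom(3) 1(3)] by (intro qfrac_mult qfrac_inverse pol 1)
  moreover have "\<forall>\<^sub>F N in sequentially. \<tau> N (w N) = \<tau> N (P N) * inverse (\<tau> N (R N))"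
    using 1(5) by eventually_elim (simp add: is_ring_homD[OF hom(1)] is_ring_hom_inverse[OF hom(1)])
  ultimately show ?thesis
    by (simp add: 1(4) is_ring_homD[OF hom(3)] is_ring_hom_inverse[OF hom(3)] qfrac_cong_eventually)
qed

lemma conv_homs_comp:
  assumes "conv_homs \<tau> t" "conv_homs \<upsilon> u"
  shows "conv_homs (\<lambda>N. \<tau> N \<circ> \<upsilon> N) (t \<circ> u)"
  using assms conv_homs_qfrac[OF assms(1)] by (auto simp: conv_homs_def is_ring_hom_comp)

end


section \<open>The quantum skew field\<close>

locale quantum_field =
  fixes Q :: "('f::division_ring, 'b) qdata"
  assumes quantum_skew_field: "quantum_skew_field Q"
begin

lemma sc_hom: "is_ring_hom (sc Q)"
  and sc_central: "central (sc Q c)"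
  and qq_central: "central (qq Q)"
  and aa_central: "k < 6 \<Longrightarrow> central (aa Q k)"
  and FG_commutation: "FF Q * GG Q = qq Q * GG Q * FF Q"
  and formal_or_numeric: "q_formal Q \<or> q_numeric Q"
  using quantum_skew_field unfolding quantum_skew_field_def by auto

lemma mono_a_0: "mono_a Q (\<lambda>_. 0) = 1"
  by (simp add: mono_a_def map_replicate_const)

lemma mono_a_single: "k < 6 \<Longrightarrow> mono_a Q (\<lambda>l. if l = k then z else 0) = aa Q k powi z"
  by (auto simp: mono_a_def upt_rec less_Suc_eq numeral_eq_Suc)

section \<open>Nonvanishing of the generators and distinctness of the powers of
  \<open>q\<close>\<close>

lemma lin_indep_single:
  assumes "lin_indep_over_C (sc Q) e I" "i \<in> I"
  shows "e i \<noteq> 0"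
proof
  assume "e i = 0"
  then show False
    using assms unfolding lin_indep_over_C_def
    by (auto dest!: spec[of _ "{i}"] spec[of _ "\<lambda>_. 1"])
qed

lemma lin_indep_pair:
  assumes "lin_indep_over_C (sc Q) e I" "i \<in> I" "j \<in> I" "i \<noteq> j"
  shows "sc Q c * e i \<noteq> e j"
proof
  assume "sc Q c * e i = e j"
  then have "(\<Sum>k\<in>{i, j}. sc Q (if k = i then c else - 1) * e k) = 0"
    using assms(4) by (auto simp: is_ring_homD[OF sc_hom])
  then have "\<forall>k\<in>{i, j}. (if k = i then c else - 1) = 0"
    using assms(1)[unfolded lin_indep_over_C_def, THEN spec[of _ "{i, j}"],
        THEN spec[of _ "\<lambda>k. if k = i then c else - 1"]] assms(2,3)
    by blast
  with assms(4) show False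
    by simp
qed

lemma lin_indep_commutative:
  "lin_indep_over_C (sc Q) (mono_qaFG Q) ({0} \<times> exponents \<times> UNIV \<times> UNIV)"
  using formal_or_numeric unfolding q_formal_def q_numeric_def lin_indep_over_C_def
  by (elim disjE conjE) (meson Sigma_mono order.refl subset_UNIV order.trans)+

lemma F_nonzero: "FF Q \<noteq> 0"
  using lin_indep_single[OF lin_indep_commutative, of "(0, \<lambda>_. 0, 1, 0)"]
  by (simp add: exponents_def mono_qaFG_def mono_a_0)

lemma G_nonzero: "GG Q \<noteq> 0"
  using lin_indep_single[OF lin_indep_commutative, of "(0, \<lambda>_. 0, 0, 1)"]
  by (simp add: exponents_def mono_qaFG_def mono_a_0)

lemma a_nonzero: "k < 6 \<Longrightarrow> aa Q k \<noteq> 0"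
  using lin_indep_single[OF lin_indep_commutative, of "(0, \<lambda>l. if l = k then 1 else 0, 0, 0)"]
  by (simp add: exponents_def mono_qaFG_def mono_a_single)

lemma q_formal_not_scalar:
  assumes "q_formal Q"
  shows "qq Q \<noteq> sc Q z"
proof
  assume "qq Q = sc Q z"
  then have "sc Q z * mono_qaFG Q (0, \<lambda>_. 0, 0, 0) = mono_qaFG Q (1, \<lambda>_. 0, 0, 0)"
    by (simp add: mono_qaFG_def mono_a_0)
  then show False
    using lin_indep_pair[of "mono_qaFG Q" "UNIV \<times> exponents \<times> UNIV \<times> UNIV"
        "(0, \<lambda>_. 0, 0, 0)" "(1, \<lambda>_. 0, 0, 0)" z] assms
    by (simp add: q_formal_def exponents_def)
qed

text \<open>\<open>scalar_lim\<close> branches on whether \<open>q\<close> is a scalar, not on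
  \<open>q_formal\<close> or \<open>q_numeric\<close>. This connects the two distinctions: the
  scalar branch occurs only for a number inside the unit disc.\<close>

lemma q_scalar_cases:
  assumes "qq Q = sc Q z"
  shows "0 < cmod z" "cmod z < 1"
proof -
  have "q_numeric Q"
    using formal_or_numeric q_formal_not_scalar assms by blast
  then obtain z' where "qq Q = sc Q z'" "0 < cmod z'" "cmod z' < 1"
    by (auto simp: q_numeric_def)
  moreover from this have "z = z'"
    using assms is_ring_hom_inj[OF sc_hom] by auto
  ultimately show "0 < cmod z" "cmod z < 1"
    by auto
qed

lemma inj_q_powers: "inj (\<lambda>N::nat. qq Q ^ N)"
  using formal_or_numeric
proof
  assume formal: "q_formal Q"
  show ?thesis
  proof (rule injI, rule ccontr)
    fix N M :: nat
    assume "qq Q ^ N = qq Q ^ M" "N \<noteq> M"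
    then show False
      using lin_indep_pair[of "mono_qaFG Q" "UNIV \<times> exponents \<times> UNIV \<times> UNIV"
          "(N, \<lambda>_. 0, 0, 0)" "(M, \<lambda>_. 0, 0, 0)" 1] formal
      by (simp add: q_formal_def exponents_def mono_qaFG_def mono_a_0 is_ring_homD[OF sc_hom])
  qed
next
  assume "q_numeric Q"
  then obtain z where z: "qq Q = sc Q z" "0 < cmod z" "cmod z < 1"
    by (auto simp: q_numeric_def)
  show ?thesis
  proof (rule injI)
    fix N M :: nat
    assume "qq Q ^ N = qq Q ^ M"
    then have "sc Q (z ^ N) = sc Q (z ^ M)"
      by (simp add: z(1) is_ring_hom_power[OF sc_hom])
    then have "cmod z ^ N = cmod z ^ M"
      using is_ring_hom_inj[OF sc_hom] by (metis norm_power)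
    with z show "N = M"
      using power_inject_exp' by (metis less_irrefl power_strict_decreasing_iff linorder_neq_iff)
  qed
qed

sublocale generic_q "qq Q"
  by unfold_locales (rule qq_central inj_q_powers)+

lemma skew_field_induct [case_names sc q a F G add mult inverse]:
  assumes "\<And>c. P (sc Q c)" "P (qq Q)" "\<And>k. k < 6 \<Longrightarrow> P (aa Q k)" "P (FF Q)" "P (GG Q)"
    and "\<And>x y. P x \<Longrightarrow> P y \<Longrightarrow> P (x + y)" and mult: "\<And>x y. P x \<Longrightarrow> P y \<Longrightarrow> P (x * y)"
    and inv: "\<And>x. P x \<Longrightarrow> x \<noteq> 0 \<Longrightarrow> P (inverse x)"
  shows "P \<phi>"
proof -
  have "P x" if "x \<in> FG_algebra Q" for x
    using that by induction (use assms in auto)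
  moreover obtain x y where "x \<in> FG_algebra Q" "y \<in> FG_algebra Q" "y \<noteq> 0" "\<phi> = x / y"
    using quantum_skew_field unfolding quantum_skew_field_def by blast
  ultimately show ?thesis
    by (auto simp: divide_inverse intro!: mult inv)
qed

text \<open>Inverses are the delicate case: the limit of the denominators must not vanish. This is
  why \<open>t\<close> is required to be a homomorphism from the outset instead of being obtained as
  a limit.\<close>

lemma conv_homsI:
  assumes hom: "\<And>N. is_ring_hom (\<tau> N)" "is_ring_hom t"
    and sc: "\<And>N c. \<tau> N (sc Q c) = sc Q c" "\<And>c. t (sc Q c) = sc Q c"
    and q: "\<And>N. \<tau> N (qq Q) = qq Q" "t (qq Q) = qq Q"
    and a: "\<And>k. k < 6 \<Longrightarrow> qfrac (\<lambda>N. \<tau> N (aa Q k)) (t (aa Q k))"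
    and FG: "qfrac (\<lambda>N. \<tau> N (FF Q)) (t (FF Q))" "qfrac (\<lambda>N. \<tau> N (GG Q)) (t (GG Q))"
  shows "conv_homs \<tau> t"
proof -
  have "qfrac (\<lambda>N. \<tau> N x) (t x)" for x
  proof (induction x rule: skew_field_induct)
    case (inverse x)
    then show ?case
      by (simp add: is_ring_hom_inverse hom is_ring_hom_nonzero qfrac_inverse)
  qed (auto simp: sc q a FG qfrac_const is_ring_homD[OF hom(1)] is_ring_homD[OF hom(2)]
      intro: qfrac_add qfrac_mult)
  then show ?thesis
    using hom q by (simp add: conv_homs_def)
qed

section \<open>Passage from \<open>qfrac\<close> to the convergence notion
  \<open>q_lim\<close>\<close>

lemma qpol_coefficients:
  assumes "qpol n w a"
  shows "\<exists>e. (\<forall>N. w N = (\<Sum>i<n. qq Q ^ (i * N) * e i)) \<and> a = (\<Sum>i<n. (if i = 0 then 1 else 0) * e i)"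
  using assms
proof (induction rule: qpol.induct)
  case (qpol_Suc n w c a)
  then obtain e where e: "\<And>N. w N = (\<Sum>i<n. qq Q ^ (i * N) * e i)"
    by blast
  have "a + qq Q ^ N * w N = (\<Sum>i<Suc n. qq Q ^ (i * N) * (case i of 0 \<Rightarrow> a | Suc j \<Rightarrow> e j))" for N
    by (simp only: sum.lessThan_Suc_shift) (simp add: e sum_distrib_left power_add mult.assoc)
  moreover have "a = (\<Sum>i<Suc n. (if i = 0 then 1 else 0) * (case i of 0 \<Rightarrow> a | Suc j \<Rightarrow> e j))"
    by (simp only: sum.lessThan_Suc_shift) simp
  ultimately show ?case
    by (intro exI[of _ "\<lambda>i. case i of 0 \<Rightarrow> a | Suc j \<Rightarrow> e j"] conjI allI)
qed simp

lemma q_poly_monom: "q_poly Q (monom 1 n) = qq Q ^ n"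
proof -
  have "q_poly Q (monom 1 n) = (\<Sum>i\<le>n. if i = n then qq Q ^ n else 0)"
    unfolding q_poly_def
    by (intro sum.cong) (auto simp: degree_monom_eq coeff_monom is_ring_homD[OF sc_hom])
  then show ?thesis
    by simp
qed

lemma q_poly_0: "q_poly Q 0 = 0"
  by (simp add: q_poly_def is_ring_homD[OF sc_hom])

text \<open>For a numerical \<open>q\<close> these are powers of a number of modulus below
  \<open>1\<close>; for a formal \<open>q\<close> the polynomial \<open>monom 1 (i * N)\<close> is
  divisible by \<open>monom 1 M\<close> once \<open>N \<ge> M\<close>. For \<open>i = 0\<close> the
  sequence is constantly \<open>1\<close>.\<close>

lemma scalar_lim_q_power: "scalar_lim Q (\<lambda>N. qq Q ^ (i * N)) (if i = 0 then 1 else 0)"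
proof (cases "qq Q \<in> range (sc Q)")
  case True
  then obtain z where z: "qq Q = sc Q z"
    by auto
  have "(\<lambda>N. z ^ (i * N)) \<longlonglongrightarrow> (if i = 0 then 1 else 0)"
  proof (cases "i = 0")
    case False
    have "cmod (z ^ i) < 1"
      using q_scalar_cases[OF z] False by (simp add: norm_power power_less_one_iff)
    then have "(\<lambda>N. (z ^ i) ^ N) \<longlonglongrightarrow> 0"
      by (rule LIMSEQ_power_zero)
    with False show ?thesis
      by (simp add: power_mult)
  qed simp
  then show ?thesis
    unfolding scalar_lim_def using True
    by (auto simp: z is_ring_hom_power[OF sc_hom] is_ring_homD[OF sc_hom]
        intro!: exI[of _ "\<lambda>N. z ^ (i * N)"] exI[of _ "if i = 0 then 1 else 0"])
next
  case False
  have "\<forall>\<^sub>F N in sequentially. monom 1 M dvd (monom 1 (i * N) - (if i = 0 then 1 else 0 :: complex poly))" for M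
  proof (cases "i = 0")
    case False
    show ?thesis
    proof (rule eventually_sequentiallyI[of M])
      fix N assume "M \<le> N"
      then have "M \<le> i * N"
        using False by (metis le_trans mult_le_mono1 mult_1 One_nat_def Suc_leI neq0_conv)
      then have "monom 1 (i * N) = monom 1 M * (monom 1 (i * N - M) :: complex poly)"
        by (simp add: mult_monom)
      with False show "monom 1 M dvd (monom 1 (i * N) - (if i = 0 then 1 else 0 :: complex poly))"
        by simp
    qed
  qed simp
  moreover have "(if i = 0 then 1 else 0) = q_poly Q (if i = 0 then 1 else 0)"
    using q_poly_monom[of 0] by (simp add: q_poly_0)
  ultimately show ?thesis
    unfolding scalar_lim_def using False q_poly_monom
    by (auto intro!: exI[of _ "\<lambda>N. monom 1 (i * N)"] exI[of _ "if i = 0 then 1 else 0 :: complex poly"])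
qed

lemma scalar_lim_0: "scalar_lim Q (\<lambda>N. 0) 0"
proof (cases "qq Q \<in> range (sc Q)")
  case True
  then show ?thesis
    unfolding scalar_lim_def
    by (auto simp: is_ring_homD[OF sc_hom] intro!: exI[of _ "\<lambda>N. 0"] exI[of _ 0])
next
  case False
  then show ?thesis
    unfolding scalar_lim_def by (auto simp: q_poly_0 intro!: exI[of _ "\<lambda>N. 0"] exI[of _ 0])
qed

text \<open>\<open>q_lim\<close> expands numerator and denominator over one family of vectors. The
  two families are therefore laid end to end, and each coefficient list is padded with zeros on the
  other block.\<close>

lemma sum_append:
  fixes x y :: "nat \<Rightarrow> 'f"
  shows "(\<Sum>i<n + m. (if i < n then x i else 0) * (if i < n then e i else f (i - n))) = (\<Sum>i<n. x i * e i)"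
    "(\<Sum>i<n + m. (if i < n then 0 else y (i - n)) * (if i < n then e i else f (i - n))) = (\<Sum>i<m. y i * f i)"
proof -
  have split: "{..<n + m} = {..<n} \<union> {n..<n + m}" "{..<n} \<inter> {n..<n + m} = {}"
    by auto
  have shift: "sum g {n..<n + m} = (\<Sum>i<m. g (n + i))" for g :: "nat \<Rightarrow> 'f"
    using sum.shift_bounds_nat_ivl[of g 0 n m] by (simp add: atLeast0LessThan add.commute)
  show "(\<Sum>i<n + m. (if i < n then x i else 0) * (if i < n then e i else f (i - n))) = (\<Sum>i<n. x i * e i)"
    "(\<Sum>i<n + m. (if i < n then 0 else y (i - n)) * (if i < n then e i else f (i - n))) = (\<Sum>i<m. y i * f i)"
    by (simp_all add: split sum.union_disjoint shift)
qed

lemma qfrac_imp_q_lim: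
  assumes "qfrac w l"
  shows "q_lim Q w l"
proof -
  from assms obtain P p R r where 1: "qpoly P p" "qpoly R r" "r \<noteq> 0" "l = p * inverse r"
    "\<forall>\<^sub>F N in sequentially. R N \<noteq> 0 \<and> w N = P N * inverse (R N)"
    by (rule qfracE)
  from 1(1) obtain n e where P: "\<And>N. P N = (\<Sum>i<n. qq Q ^ (i * N) * e i)" "p = (\<Sum>i<n. (if i = 0 then 1 else 0) * e i)"
    unfolding qpoly_def using qpol_coefficients by metis
  from 1(2) obtain m f where R: "\<And>N. R N = (\<Sum>i<m. qq Q ^ (i * N) * f i)" "r = (\<Sum>i<m. (if i = 0 then 1 else 0) * f i)"
    unfolding qpoly_def using qpol_coefficients by metis
  define g where "g i = (if i < n then e i else f (i - n))" for i
  define c where "c i N = (if i < n then qq Q ^ (i * N) else 0)" for i N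
  define c' where "c' i = (if i < n then if i = 0 then 1 else 0 else 0 :: 'f)" for i
  define d where "d i N = (if i < n then 0 else qq Q ^ ((i - n) * N))" for i N
  define d' where "d' i = (if i < n then 0 else if i - n = 0 then 1 else 0 :: 'f)" for i
  have cg: "(\<Sum>i<n + m. c i N * g i) = P N" for N
    unfolding c_def g_def P(1) by (rule sum_append(1))
  have c'g: "(\<Sum>i<n + m. c' i * g i) = p"
    unfolding c'_def g_def P(2) by (rule sum_append(1))
  have dg: "(\<Sum>i<n + m. d i N * g i) = R N" for N
    unfolding d_def g_def R(1) by (rule sum_append(2))
  have d'g: "(\<Sum>i<n + m. d' i * g i) = r"
    unfolding d'_def g_def R(2) by (rule sum_append(2))
  have lims: "scalar_lim Q (c i) (c' i)" "scalar_lim Q (d i) (d' i)" for i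
  proof -
    show "scalar_lim Q (c i) (c' i)"
      using scalar_lim_q_power[of i] scalar_lim_0 unfolding c_def c'_def by (cases "i < n") auto
    show "scalar_lim Q (d i) (d' i)"
      using scalar_lim_q_power[of "i - n"] scalar_lim_0 unfolding d_def d'_def by (cases "i < n") auto
  qed
  show ?thesis
    unfolding q_lim_def
    by (rule exI[of _ "n + m"], rule exI[of _ g], rule exI[of _ c], rule exI[of _ d],
        rule exI[of _ c'], rule exI[of _ d'])
      (use 1(3-5) lims in \<open>simp add: cg c'g dg d'g divide_inverse\<close>)
qed


section \<open>Conjugation by the infinite products\<close>

lemma qpoch_0: "qpoch Q x 0 = 1"
  by (simp add: qpoch_def)

lemma qpoch_Suc: "qpoch Q x (Suc N) = qpoch Q x N * (1 + x * qq Q ^ N)"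
  by (simp add: qpoch_def)

lemma qpoch_intertwine:
  assumes "w * x = y * w"
  shows "w * qpoch Q x N = qpoch Q y N * w"
proof (induction N)
  case (Suc N)
  have "w * qpoch Q x (Suc N) = qpoch Q y N * (w * (1 + x * qq Q ^ N))"
    by (simp add: qpoch_Suc flip: mult.assoc Suc.IH)
  also have "w * (1 + x * qq Q ^ N) = w + y * (w * qq Q ^ N)"
    by (simp add: distrib_left assms flip: mult.assoc)
  also have "\<dots> = (1 + y * qq Q ^ N) * w"
    by (simp add: distrib_right mult.assoc q_power_commute)
  finally show ?case
    by (simp add: qpoch_Suc mult.assoc)
qed (simp add: qpoch_0)

lemma qpoch_commute: "w * x = x * w \<Longrightarrow> w * qpoch Q x N = qpoch Q x N * w"
  by (rule qpoch_intertwine)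

lemma qpoch_factors_commute: "(1 + x * qq Q ^ n) * (1 + x * qq Q ^ m) = (1 + x * qq Q ^ m) * (1 + x * qq Q ^ n)"
proof -
  have "x * qq Q ^ n * (x * qq Q ^ m) = x * x * qq Q ^ (n + m)" for n m
  proof -
    have "x * qq Q ^ n * (x * qq Q ^ m) = x * (qq Q ^ n * x) * qq Q ^ m"
      by (simp only: mult.assoc)
    then show ?thesis
      by (simp only: q_power_commute[of n x] mult.assoc power_add)
  qed
  then show ?thesis
    by (simp add: distrib_left distrib_right add_ac)
qed

text \<open>Both sides are the product of \<open>1 + x * q ^ m\<close> over
  \<open>m = 0, ..., N\<close>. This is the truncated form of the functional equation relating the
  infinite products at \<open>q x\<close> and \<open>x\<close>; the truncation only leaves the
  factor \<open>1 + x * q ^ N\<close>.\<close>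

lemma qpoch_shift: "qpoch Q (qq Q * x) N * (1 + x) = (1 + x * qq Q ^ N) * qpoch Q x N"
proof (induction N)
  case (Suc N)
  let ?u = "\<lambda>n. 1 + x * qq Q ^ n"
  have qx: "qq Q * x * qq Q ^ N = x * qq Q ^ Suc N"
    by (simp add: q_commute mult.assoc)
  have comm: "?u n * qpoch Q x m = qpoch Q x m * ?u n" for n m
    using qpoch_factors_commute[of x n 0] by (intro qpoch_commute) (simp add: distrib_left distrib_right)
  have "qpoch Q (qq Q * x) (Suc N) * (1 + x) = qpoch Q (qq Q * x) N * (?u (Suc N) * ?u 0)"
    unfolding qpoch_Suc qx by (simp only: mult.assoc power_0 mult_1_right)
  also have "\<dots> = qpoch Q (qq Q * x) N * (1 + x) * ?u (Suc N)"
    unfolding qpoch_factors_commute[of x "Suc N" 0] by (simp only: mult.assoc power_0 mult_1_right)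
  also have "\<dots> = ?u N * (qpoch Q x N * ?u (Suc N))"
    by (simp only: Suc.IH mult.assoc)
  also have "\<dots> = ?u N * ?u (Suc N) * qpoch Q x N"
    by (simp only: comm[symmetric] mult.assoc)
  also have "?u N * ?u (Suc N) = ?u (Suc N) * ?u N"
    by (rule qpoch_factors_commute)
  finally show ?case
    by (simp only: qpoch_Suc mult.assoc comm)
qed (simp add: qpoch_0)

text \<open>Otherwise \<open>c * x = - 1\<close> would commute with \<open>w\<close>, while it also
  commutes up to the factor \<open>q \<noteq> 1\<close>. This is the source of all nonvanishing
  needed below, for truncated factors (\<open>c\<close> a power of \<open>q\<close>) as well as for
  their limits.\<close>

lemma q_commuting_not_central:
  assumes "w * x = qq Q * x * w" "w \<noteq> 0" "x \<noteq> 0" "central c"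
  shows "1 + c * x \<noteq> 0"
proof
  assume "1 + c * x = 0"
  then have cx: "c * x = - 1"
    by (metis add_eq_0_iff)
  have "w * (c * x) = c * (w * x)"
    using assms(4) by (metis central_def mult.assoc)
  also have "\<dots> = qq Q * (c * x) * w"
    by (simp add: assms(1) mult.assoc q_left_commute)
  finally have "(qq Q - 1) * w = 0"
    by (simp add: cx left_diff_distrib)
  with assms(2) q_neq_1 show False
    by simp
qed

lemma central_intros:
  "central (1 :: 'f)" "central x \<Longrightarrow> central y \<Longrightarrow> central (x * y)" "central x \<Longrightarrow> central (x ^ n)"
  "central x \<Longrightarrow> central (inverse x)" for x y :: 'f
proof -
  show 1: "central (1 :: 'f)"
    by (simp add: central_def)
  show 2: "central x \<Longrightarrow> central y \<Longrightarrow> central (x * y)" for x y :: 'f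
    unfolding central_def by (metis mult.assoc)
  show "central x \<Longrightarrow> central (x ^ n)"
    by (induction n) (auto simp: 1 2)
  show "central x \<Longrightarrow> central (inverse x)"
  proof (cases "x = 0")
    case False
    assume "central x"
    then have "inverse x * (y * x) * inverse x = inverse x * (x * y) * inverse x" for y
      by (simp add: central_def)
    moreover have "inverse x * (y * x) * inverse x = inverse x * y" for y
      using False by (simp add: mult.assoc)
    moreover have "inverse x * (x * y) * inverse x = y * inverse x" for y
      using False by (simp flip: mult.assoc)
    ultimately show ?thesis
      by (simp add: central_def)
  qed simp
qed

lemma qpoch_nonzero:
  assumes "w * x = qq Q * x * w" "w \<noteq> 0" "x \<noteq> 0"
  shows "qpoch Q x N \<noteq> 0"
proof (induction N)
  case (Suc N)
  have "1 + x * qq Q ^ N \<noteq> 0"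
    using q_commuting_not_central[OF assms central_intros(3)[OF qq_central]] by (simp add: q_power_commute)
  with Suc show ?case
    by (simp add: qpoch_Suc)
qed (simp add: qpoch_0)

lemma q_commuting_inverse:
  assumes "x * w = qq Q * w * x" "w \<noteq> 0"
  shows "inverse w * x = qq Q * x * inverse w"
proof -
  have "inverse w * (x * w) * inverse w = inverse w * (qq Q * w * x) * inverse w"
    by (simp add: assms(1))
  moreover have "inverse w * (x * w) * inverse w = inverse w * x"
    using assms(2) by (simp add: mult.assoc)
  moreover have "inverse w * (qq Q * w * x) * inverse w = qq Q * x * inverse w"
  proof -
    have "inverse w * (qq Q * w * x) * inverse w = qq Q * ((inverse w * w) * x * inverse w)"
      by (simp only: mult.assoc q_left_commute)
    then show ?thesis
      using assms(2) by (simp add: mult.assoc)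
  qed
  ultimately show ?thesis
    by simp
qed

text \<open>Moving \<open>w\<close> through the product replaces \<open>x\<close> by
  \<open>q * x\<close>, so conjugation multiplies \<open>w\<close> by the quotient of the products
  at \<open>x\<close> and at \<open>q * x\<close>. By telescoping, the \<open>N\<close> factors
  collapse to an expression in \<open>q ^ N\<close>; this is where rationality in
  \<open>q ^ N\<close> originates.\<close>

lemma Ad_qpoch:
  assumes "w * x = qq Q * x * w" "w \<noteq> 0" "x \<noteq> 0"
  shows "Ad (qpoch Q x N) w = inverse (1 + x * qq Q ^ N) * (1 + x) * w"
    "Ad (inverse (qpoch Q x N)) w = inverse (1 + x) * (1 + x * qq Q ^ N) * w"
proof -
  let ?C = "qpoch Q x N" and ?u = "1 + x * qq Q ^ N"
  have C: "?C \<noteq> 0"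
    by (rule qpoch_nonzero[OF assms])
  have u: "?u \<noteq> 0"
    using q_commuting_not_central[OF assms central_intros(3)[OF qq_central]] by (simp add: q_power_commute)
  have v: "1 + x \<noteq> 0"
    using q_commuting_not_central[OF assms central_intros(1)] by simp
  have "?u * ?C * w = qpoch Q (qq Q * x) N * (1 + x) * w"
    by (simp add: qpoch_shift)
  also have "qpoch Q (qq Q * x) N * (1 + x) = (1 + x) * qpoch Q (qq Q * x) N"
    by (rule qpoch_commute[symmetric]) (simp add: distrib_left distrib_right mult.assoc q_left_commute)
  also have "\<dots> * w = (1 + x) * (w * ?C)"
    by (simp add: mult.assoc qpoch_intertwine[OF assms(1)])
  finally have eq: "?u * (?C * w) = (1 + x) * (w * ?C)"
    by (simp add: mult.assoc)
  have "Ad ?C w = inverse ?u * (?u * (?C * w)) * inverse ?C"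
    using C u by (simp add: Ad_def unit_inv_division flip: mult.assoc)
  also have "\<dots> = inverse ?u * (1 + x) * w"
    using C by (simp add: eq) (simp add: mult.assoc)
  finally show "Ad ?C w = inverse ?u * (1 + x) * w" .
  have uC: "?u * ?C = ?C * ?u" "(1 + x) * ?C = ?C * (1 + x)"
    by (rule qpoch_commute, simp add: distrib_left distrib_right mult.assoc q_power_commute)+
  have "inverse ?C * inverse (1 + x) = inverse (1 + x) * inverse ?C"
    using C v uC(2) by (simp flip: nonzero_inverse_mult_distrib)
  moreover have "w * ?C = inverse (1 + x) * (?u * (?C * w))"
    unfolding eq using v by (simp flip: mult.assoc)
  ultimately have "inverse ?C * (w * ?C) = inverse (1 + x) * (inverse ?C * ?u * ?C * w)"
    by (simp flip: mult.assoc)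
  also have "inverse ?C * ?u * ?C = ?u"
    using C by (simp add: mult.assoc uC(1)) (simp flip: mult.assoc)
  finally show "Ad (inverse ?C) w = inverse (1 + x) * ?u * w"
    using C by (simp add: Ad_def unit_inv_division mult.assoc)
qed

text \<open>Weaker than \<open>conv_homs\<close>, as no limit map is demanded. It describes the
  outer conjugations accumulated so far, for which only the limits of a few chosen elements are
  tracked; by \<open>Ad (c * d) = Ad c \<circ> Ad d\<close>, each further factor is inserted on the
  inside.\<close>

definition hom_seq :: "(nat \<Rightarrow> 'f \<Rightarrow> 'f) \<Rightarrow> bool" where
  "hom_seq \<kappa> \<longleftrightarrow> (\<forall>N. is_ring_hom (\<kappa> N) \<and> \<kappa> N (qq Q) = qq Q)"

lemma hom_seq_id: "hom_seq (\<lambda>N x. x)"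
  by (simp add: hom_seq_def is_ring_hom_id)

lemma hom_seq_Ad:
  assumes "hom_seq \<kappa>" "\<And>N. c N \<noteq> 0"
  shows "hom_seq (\<lambda>N x. \<kappa> N (Ad (c N) x))"
proof -
  have "Ad (c N) (qq Q) = qq Q" for N
    using assms(2) by (intro Ad_commute) (simp_all add: is_unit_of_division q_commute)
  moreover have "is_ring_hom (\<lambda>x. \<kappa> N (Ad (c N) x))" for N
    using assms is_ring_hom_comp[OF _ is_ring_hom_Ad[of "c N"], of "\<kappa> N"]
    by (simp add: hom_seq_def is_unit_of_division o_def)
  ultimately show ?thesis
    using assms(1) by (simp add: hom_seq_def)
qed

lemma hom_seq_inverse:
  assumes "hom_seq \<kappa>" "qfrac (\<lambda>N. \<kappa> N w) w'" "w' \<noteq> 0"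
  shows "qfrac (\<lambda>N. \<kappa> N (inverse w)) (inverse w')"
  using qfrac_inverse[OF assms(2,3)] assms(1) by (simp add: hom_seq_def is_ring_hom_inverse)

lemma hom_seq_mult:
  assumes "hom_seq \<kappa>" "qfrac (\<lambda>N. \<kappa> N w) w'" "qfrac (\<lambda>N. \<kappa> N x) x'"
  shows "qfrac (\<lambda>N. \<kappa> N (w * x)) (w' * x')"
  using qfrac_mult[OF assms(2,3)] assms(1) by (simp add: hom_seq_def is_ring_homD)

lemma hom_seq_q: "hom_seq \<kappa> \<Longrightarrow> qfrac (\<lambda>N. \<kappa> N (qq Q)) (qq Q)"
  by (simp add: hom_seq_def qfrac_const)

lemma hom_seq_limit_nonzero:
  assumes "hom_seq \<kappa>" "qfrac (\<lambda>N. \<kappa> N w) w'" "w' \<noteq> 0"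
  shows "w \<noteq> 0"
proof
  assume "w = 0"
  with assms have "qfrac (\<lambda>N. 0) w'"
    by (simp add: hom_seq_def is_ring_homD)
  with assms(3) qfrac_zero_limit show False
    by blast
qed

text \<open>Both sides of the relation converge along the same sequence, so uniqueness of limits
  applies. The relation is needed for the limits in order to know that \<open>1 + x'\<close> is
  invertible.\<close>

lemma hom_seq_q_commuting:
  assumes "hom_seq \<kappa>" "w * x = qq Q * x * w" "qfrac (\<lambda>N. \<kappa> N w) w'" "qfrac (\<lambda>N. \<kappa> N x) x'"
  shows "w' * x' = qq Q * x' * w'"
proof (rule qfrac_unique)
  show "qfrac (\<lambda>N. \<kappa> N (w * x)) (w' * x')"
    using assms by (intro hom_seq_mult)
  show "qfrac (\<lambda>N. \<kappa> N (w * x)) (qq Q * x' * w')"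
    unfolding assms(2) using assms by (intro hom_seq_mult hom_seq_q)
qed

text \<open>\<open>\<kappa> N\<close> fixes \<open>q ^ N\<close>, so it can be pushed through the
  closed formula of \<open>Ad_qpoch\<close>; then \<open>q ^ N\<close> is replaced by
  \<open>0\<close>.\<close>

lemma hom_seq_Ad_qpoch:
  assumes "hom_seq \<kappa>" "w * x = qq Q * x * w" "qfrac (\<lambda>N. \<kappa> N w) w'" "qfrac (\<lambda>N. \<kappa> N x) x'"
    "w' \<noteq> 0" "x' \<noteq> 0"
  shows "qfrac (\<lambda>N. \<kappa> N (Ad (qpoch Q x N) w)) ((1 + x') * w')"
    "qfrac (\<lambda>N. \<kappa> N (Ad (inverse (qpoch Q x N)) w)) (inverse (1 + x') * w')"
proof -
  have \<kappa>: "is_ring_hom (\<kappa> N)" "\<kappa> N (qq Q) = qq Q" for N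
    using assms(1) by (auto simp: hom_seq_def)
  have nz: "w \<noteq> 0" "x \<noteq> 0"
    using assms hom_seq_limit_nonzero by blast+
  have x': "1 + x' \<noteq> 0"
    using q_commuting_not_central[OF hom_seq_q_commuting[OF assms(1-4)] assms(5,6) central_intros(1)] by simp
  have \<kappa>_factor: "\<kappa> N (1 + x * qq Q ^ n) = 1 + \<kappa> N x * qq Q ^ n" "\<kappa> N (1 + x) = 1 + \<kappa> N x" for N n
    by (simp_all add: is_ring_homD(1-3)[OF \<kappa>(1)] is_ring_hom_power[OF \<kappa>(1)] \<kappa>(2))
  have lim: "qfrac (\<lambda>N. 1 + \<kappa> N x * qq Q ^ N) (1 + x' * 0)" "qfrac (\<lambda>N. 1 + \<kappa> N x) (1 + x')"
    using assms(4) by (intro qfrac_mult qfrac_add qfrac_const qfrac_power; assumption)+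
  have "\<kappa> N (Ad (qpoch Q x N) w) = inverse (1 + \<kappa> N x * qq Q ^ N) * (1 + \<kappa> N x) * \<kappa> N w" for N
    by (simp only: Ad_qpoch[OF assms(2) nz] is_ring_homD(3)[OF \<kappa>(1)] is_ring_hom_inverse[OF \<kappa>(1)] \<kappa>_factor)
  moreover have "qfrac (\<lambda>N. inverse (1 + \<kappa> N x * qq Q ^ N) * (1 + \<kappa> N x) * \<kappa> N w) (inverse (1 + x' * 0) * (1 + x') * w')"
    by (rule qfrac_mult[OF qfrac_mult[OF qfrac_inverse[OF lim(1)] lim(2)] assms(3)]) simp
  ultimately show "qfrac (\<lambda>N. \<kappa> N (Ad (qpoch Q x N) w)) ((1 + x') * w')"
    by simp
  have "\<kappa> N (Ad (inverse (qpoch Q x N)) w) = inverse (1 + \<kappa> N x) * (1 + \<kappa> N x * qq Q ^ N) * \<kappa> N w" for N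
    by (simp only: Ad_qpoch[OF assms(2) nz] is_ring_homD(3)[OF \<kappa>(1)] is_ring_hom_inverse[OF \<kappa>(1)] \<kappa>_factor)
  moreover have "qfrac (\<lambda>N. inverse (1 + \<kappa> N x) * (1 + \<kappa> N x * qq Q ^ N) * \<kappa> N w) (inverse (1 + x') * (1 + x' * 0) * w')"
    by (rule qfrac_mult[OF qfrac_mult[OF qfrac_inverse[OF lim(2) x'] lim(1)] assms(3)])
  ultimately show "qfrac (\<lambda>N. \<kappa> N (Ad (inverse (qpoch Q x N)) w)) (inverse (1 + x') * w')"
    by simp
qed

text \<open>The opposite commutation relation is reduced to the previous one through
  \<open>inverse w\<close>. Inverting the result moves the factor to the right of \<open>w'\<close>
  and exchanges the two cases.\<close>

lemma hom_seq_Ad_qpoch':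
  assumes "hom_seq \<kappa>" "x * w = qq Q * w * x" "qfrac (\<lambda>N. \<kappa> N w) w'" "qfrac (\<lambda>N. \<kappa> N x) x'"
    "w' \<noteq> 0" "x' \<noteq> 0"
  shows "qfrac (\<lambda>N. \<kappa> N (Ad (qpoch Q x N) w)) (w' * inverse (1 + x'))"
    "qfrac (\<lambda>N. \<kappa> N (Ad (inverse (qpoch Q x N)) w)) (w' * (1 + x'))"
proof -
  have nz: "w \<noteq> 0" "x \<noteq> 0"
    using assms hom_seq_limit_nonzero by blast+
  have comm: "inverse w * x = qq Q * x * inverse w"
    using assms(2) nz(1) by (rule q_commuting_inverse)
  have lim: "qfrac (\<lambda>N. \<kappa> N (inverse w)) (inverse w')" "inverse w' \<noteq> 0"
    using assms hom_seq_inverse by auto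
  have x': "1 + x' \<noteq> 0"
    using q_commuting_not_central[OF hom_seq_q_commuting[OF assms(1) comm lim(1) assms(4)] lim(2) assms(6)
        central_intros(1)] by simp
  have C: "qpoch Q x N \<noteq> 0" for N
    using qpoch_nonzero[OF comm] nz by simp
  have inv: "\<kappa> N (Ad c w) = inverse (\<kappa> N (Ad c (inverse w)))" if "c \<noteq> 0" for N c
    using that assms(1) is_ring_hom_inverse[OF is_ring_hom_Ad[of c], of w] is_ring_hom_inverse[of "\<kappa> N"]
    by (simp add: hom_seq_def is_unit_of_division)
  have "qfrac (\<lambda>N. inverse (\<kappa> N (Ad (qpoch Q x N) (inverse w)))) (inverse ((1 + x') * inverse w'))"
    using x' lim(2) by (intro qfrac_inverse hom_seq_Ad_qpoch(1)[OF assms(1) comm lim(1) assms(4) lim(2) assms(6)]) auto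
  with x' assms(5) C show "qfrac (\<lambda>N. \<kappa> N (Ad (qpoch Q x N) w)) (w' * inverse (1 + x'))"
    by (simp add: inv nonzero_inverse_mult_distrib)
  have "qfrac (\<lambda>N. inverse (\<kappa> N (Ad (inverse (qpoch Q x N)) (inverse w)))) (inverse (inverse (1 + x') * inverse w'))"
    using x' lim(2) by (intro qfrac_inverse hom_seq_Ad_qpoch(2)[OF assms(1) comm lim(1) assms(4) lim(2) assms(6)]) auto
  with x' assms(5) C show "qfrac (\<lambda>N. \<kappa> N (Ad (inverse (qpoch Q x N)) w)) (w' * (1 + x'))"
    by (simp add: inv nonzero_inverse_mult_distrib)
qed


section \<open>Stability of the commutation relations, and the theta factors\<close>

lemma Ad_division_mult: "c \<noteq> 0 \<Longrightarrow> d \<noteq> 0 \<Longrightarrow> Ad (c * d) x = Ad c (Ad d x)" for c d x :: 'f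
  by (rule Ad_mult) (simp_all add: is_unit_of_division)

lemma q_commuting_scale:
  assumes "w * x = qq Q * x * w" "central c"
  shows "w * (c * x) = qq Q * (c * x) * w"
proof -
  have "w * (c * x) = c * (w * x)"
    using assms(2) unfolding central_def by (metis mult.assoc)
  also have "\<dots> = (c * qq Q) * x * w"
    by (simp only: assms(1) mult.assoc)
  also have "c * qq Q = qq Q * c"
    by (rule q_commute[symmetric])
  finally show ?thesis
    by (simp only: mult.assoc)
qed

lemma q_commuting_scale':
  assumes "x * w = qq Q * w * x" "central c"
  shows "(c * x) * w = qq Q * w * (c * x)"
proof -
  have "(c * x) * w = c * (qq Q * w) * x"
    by (simp only: assms(1) mult.assoc)
  also have "c * (qq Q * w) = qq Q * w * c"
    using assms(2) by (simp add: central_def)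
  finally show ?thesis
    by (simp only: mult.assoc)
qed

lemma commute_scale:
  assumes "v * x = x * v" "central c"
  shows "v * (c * x) = (c * x) * v"
proof -
  have "v * (c * x) = c * (v * x)"
    using assms(2) unfolding central_def by (metis mult.assoc)
  then show ?thesis
    by (simp only: assms(1) mult.assoc)
qed

lemma commute_inverse:
  fixes x :: 'f
  assumes "v * x = x * v"
  shows "v * inverse x = inverse x * v"
proof (cases "x = 0")
  case False
  have "inverse x * (x * v) * inverse x = inverse x * (v * x) * inverse x"
    by (simp only: assms)
  moreover have "inverse x * (x * v) * inverse x = v * inverse x"
    using False by (simp flip: mult.assoc)
  moreover have "inverse x * (v * x) * inverse x = inverse x * v"
    using False by (simp add: mult.assoc)
  ultimately show ?thesis
    by simp
qed simp

lemma q_commuting_q_inverse: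
  assumes "w * x = qq Q * x * w" "x \<noteq> 0"
  shows "(qq Q * inverse x) * w = qq Q * w * (qq Q * inverse x)"
  by (rule q_commuting_scale'[OF q_commuting_inverse[OF assms] qq_central])

lemma theta_nonzero:
  assumes "w * x = qq Q * x * w" "w \<noteq> 0" "x \<noteq> 0"
  shows "theta Q x N \<noteq> 0"
proof -
  have "inverse w * (qq Q * inverse x) = qq Q * (qq Q * inverse x) * inverse w"
    by (rule q_commuting_inverse[OF q_commuting_q_inverse[OF assms(1,3)] assms(2)])
  then have "qpoch Q (qq Q * inverse x) N \<noteq> 0"
    by (rule qpoch_nonzero) (use assms q_nonzero in auto)
  with qpoch_nonzero[OF assms] show ?thesis
    by (simp add: theta_def)
qed

lemma theta_commute:
  assumes "w * x = x * w"
  shows "theta Q x N * w = w * theta Q x N"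
proof -
  have "w * (qq Q * inverse x) = qq Q * inverse x * w"
    by (rule commute_scale[OF commute_inverse[OF assms] qq_central])
  then show ?thesis
    using qpoch_commute[OF assms, of N] qpoch_commute[of w "qq Q * inverse x" N]
    by (simp add: theta_def flip: mult.assoc) (simp add: mult.assoc)
qed

text \<open>The limit reflects the quasi-periodicity \<open>\<theta>(q X) = X\<^sup>-\<^sup>1 \<theta>(X)\<close>.\<close>

lemma hom_seq_Ad_theta:
  assumes "hom_seq \<kappa>" "w * x = qq Q * x * w" "qfrac (\<lambda>N. \<kappa> N w) w'" "qfrac (\<lambda>N. \<kappa> N x) x'"
    "w' \<noteq> 0" "x' \<noteq> 0"
  shows "qfrac (\<lambda>N. \<kappa> N (Ad (theta Q x N) w)) (x' * w')"
proof -
  have nz: "w \<noteq> 0" "x \<noteq> 0"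
    using assms hom_seq_limit_nonzero by blast+
  have w'x': "w' * x' = qq Q * x' * w'"
    by (rule hom_seq_q_commuting[OF assms(1-4)])
  have x1: "1 + x' \<noteq> 0"
    using q_commuting_not_central[OF w'x' assms(5,6) central_intros(1)] by simp
  define y where "y = qq Q * inverse x"
  define y' where "y' = qq Q * inverse x'"
  have C: "qpoch Q x N \<noteq> 0" "qpoch Q y N \<noteq> 0" for N
    using theta_nonzero[OF assms(2) nz, of N] by (auto simp: theta_def y_def)
  \<comment> \<open>The first half of theta joins the outer maps. It commutes with \<open>x\<close>,
    so the limits of \<open>x\<close> and of \<open>y = q / x\<close> are unaffected, while
    \<open>w\<close> acquires the factor \<open>1 + x'\<close>.\<close>
  define \<kappa>' where "\<kappa>' = (\<lambda>N z. \<kappa> N (Ad (qpoch Q x N) z))"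
  have \<kappa>': "hom_seq \<kappa>'"
    unfolding \<kappa>'_def by (rule hom_seq_Ad[OF assms(1) C(1)])
  have "Ad (qpoch Q x N) x = x" for N
    using C by (intro Ad_commute) (simp_all add: is_unit_of_division flip: qpoch_commute)
  then have "qfrac (\<lambda>N. \<kappa>' N x) x'"
    using assms(4) by (simp add: \<kappa>'_def)
  then have y': "qfrac (\<lambda>N. \<kappa>' N y) y'"
    unfolding y_def y'_def by (intro hom_seq_mult hom_seq_inverse hom_seq_q \<kappa>' assms(6))
  have w': "qfrac (\<lambda>N. \<kappa>' N w) ((1 + x') * w')"
    unfolding \<kappa>'_def by (rule hom_seq_Ad_qpoch(1)[OF assms])
  have yw: "y * w = qq Q * w * y"
    unfolding y_def by (rule q_commuting_q_inverse[OF assms(2) nz(2)])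
  have "qfrac (\<lambda>N. \<kappa>' N (Ad (qpoch Q y N) w)) ((1 + x') * w' * inverse (1 + y'))"
    by (rule hom_seq_Ad_qpoch'(1)[OF \<kappa>' yw w' y']) (use x1 assms(5,6) q_nonzero in \<open>auto simp: y'_def\<close>)
  moreover have "Ad (theta Q x N) w = Ad (qpoch Q x N) (Ad (qpoch Q y N) w)" for N
    using C by (simp add: theta_def y_def Ad_division_mult)
  moreover have "(1 + x') * w' * inverse (1 + y') = x' * w'"
  proof -
    \<comment> \<open>The \<open>q\<close> in \<open>y' = q * inverse x'\<close> is exactly the one
      produced when \<open>inverse x'\<close> passes \<open>w'\<close>. Hence
      \<open>x' * w' * y' = w'\<close>, and the factor \<open>1 + y'\<close> cancels against
      \<open>1 + x'\<close>, leaving \<open>x'\<close>.\<close>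
    have "x' * w' * y' = (qq Q * x' * w') * inverse x'"
      unfolding y'_def by (metis mult.assoc q_commute)
    also have "\<dots> = w'"
      unfolding w'x'[symmetric] using assms(6) by (simp add: mult.assoc)
    finally have "(1 + x') * w' = x' * w' * (1 + y')"
      by (simp add: distrib_left distrib_right)
    moreover have "1 + y' \<noteq> 0"
    proof
      assume "1 + y' = 0"
      with \<open>(1 + x') * w' = x' * w' * (1 + y')\<close> x1 assms(5) show False
        by simp
    qed
    ultimately show ?thesis
      by (simp add: mult.assoc)
  qed
  ultimately show ?thesis
    by (simp add: \<kappa>'_def)
qed

text \<open>All four products are built from \<open>X\<close>, so they fix one another's arguments
  and their effects on \<open>w\<close> accumulate: \<open>(1 + q X) w = w (1 + X)\<close>, then
  division by \<open>1 + 1/X\<close>, multiplication by \<open>1 + z/X\<close>, and division by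
  \<open>1 + z q X\<close>, which is \<open>1 + z X\<close> after passing \<open>w\<close>. Since
  \<open>(1 + X) / (1 + 1/X) = X\<close> and \<open>X (1 + z/X) = X + z\<close>, the stated quotient
  remains. The nonvanishing claims allow the limit to be inverted later.\<close>

lemma Psi_limit:
  assumes wX: "w * X = qq Q * X * w" and nz: "w \<noteq> 0" "X \<noteq> 0" "z \<noteq> 0" and z: "central z"
  shows "Psi Q z X N \<noteq> 0"
    and "qfrac (\<lambda>N. Ad (Psi Q z X N) w) (w * ((X + z) * inverse (1 + z * X)))"
    and "v * X = X * v \<Longrightarrow> Ad (Psi Q z X N) v = v"
    and "X + z \<noteq> 0" "1 + z * X \<noteq> 0"
proof -
  define x1 where "x1 = qq Q * X"
  define x2 where "x2 = inverse X"
  define x3 where "x3 = z * qq Q * X"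
  define x4 where "x4 = z * inverse X"
  have zc: "y * (z * x) = z * (y * x)" for x y
    using z unfolding central_def by (metis mult.assoc)
  have zq: "central (z * qq Q)"
    by (rule central_intros(2)[OF z qq_central])
  have 1: "w * x1 = qq Q * x1 * w"
    unfolding x1_def by (rule q_commuting_scale[OF wX qq_central])
  have 2: "x2 * w = qq Q * w * x2"
    unfolding x2_def by (rule q_commuting_inverse[OF wX nz(2)])
  have 3: "w * x3 = qq Q * x3 * w"
    unfolding x3_def by (rule q_commuting_scale[OF wX zq])
  have 4: "x4 * w = qq Q * w * x4"
    unfolding x4_def using 2[unfolded x2_def] z by (rule q_commuting_scale')
  have x_nz: "x1 \<noteq> 0" "x2 \<noteq> 0" "x3 \<noteq> 0" "x4 \<noteq> 0"
    using nz q_nonzero by (auto simp: x1_def x2_def x3_def x4_def)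
  have inv_w: "inverse w * x2 = qq Q * x2 * inverse w" "inverse w * x4 = qq Q * x4 * inverse w"
    by (rule q_commuting_inverse[OF 2 nz(1)], rule q_commuting_inverse[OF 4 nz(1)])
  have one: "1 + x1 \<noteq> 0" "1 + x2 \<noteq> 0" "1 + x3 \<noteq> 0" "1 + x4 \<noteq> 0"
    using q_commuting_not_central[OF 1 nz(1) x_nz(1) central_intros(1)]
      q_commuting_not_central[OF inv_w(1) _ x_nz(2) central_intros(1)]
      q_commuting_not_central[OF 3 nz(1) x_nz(3) central_intros(1)]
      q_commuting_not_central[OF inv_w(2) _ x_nz(4) central_intros(1)] nz(1) by auto
  have C: "qpoch Q x1 N \<noteq> 0" "qpoch Q x2 N \<noteq> 0" "qpoch Q x3 N \<noteq> 0" "qpoch Q x4 N \<noteq> 0" for N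
    using qpoch_nonzero[OF 1] qpoch_nonzero[OF inv_w(1)] qpoch_nonzero[OF 3] qpoch_nonzero[OF inv_w(2)]
      nz(1) x_nz by auto
  have Psi: "Psi Q z X N = qpoch Q x1 N * qpoch Q x2 N * inverse (qpoch Q x4 N) * inverse (qpoch Q x3 N)" for N
    using C[of N] by (simp add: Psi_def x1_def x2_def x3_def x4_def divide_inverse
        nonzero_inverse_mult_distrib mult.assoc)
  then show "Psi Q z X N \<noteq> 0"
    using C by simp
  have Ad_Psi: "Ad (Psi Q z X N) u = Ad (qpoch Q x1 N) (Ad (qpoch Q x2 N)
      (Ad (inverse (qpoch Q x4 N)) (Ad (inverse (qpoch Q x3 N)) u)))" for N u
    using C[of N] by (simp add: Psi Ad_division_mult)
  have Ad_X: "Ad (qpoch Q x1 N) v = v" "Ad (qpoch Q x2 N) v = v"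
    "Ad (inverse (qpoch Q x3 N)) v = v" "Ad (inverse (qpoch Q x4 N)) v = v" if v: "v * X = X * v" for N v
  proof -
    have vx: "v * x1 = x1 * v" "v * x2 = x2 * v" "v * x3 = x3 * v" "v * x4 = x4 * v"
      unfolding x1_def x2_def x3_def x4_def
      using v by (blast intro: commute_scale commute_inverse qq_central zq z)+
    note C_commute = vx[THEN qpoch_commute[of v _ N]]
    show "Ad (qpoch Q x1 N) v = v" "Ad (qpoch Q x2 N) v = v"
      "Ad (inverse (qpoch Q x3 N)) v = v" "Ad (inverse (qpoch Q x4 N)) v = v"
      using C[of N] C_commute commute_inverse[OF C_commute(3)] commute_inverse[OF C_commute(4)]
      by (simp_all add: Ad_commute is_unit_of_division)
  qed
  then show "v * X = X * v \<Longrightarrow> Ad (Psi Q z X N) v = v"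
    by (simp add: Ad_Psi)
  define \<kappa>1 where "\<kappa>1 = (\<lambda>N. Ad (qpoch Q x1 N))"
  define \<kappa>2 where "\<kappa>2 = (\<lambda>N u. \<kappa>1 N (Ad (qpoch Q x2 N) u))"
  define \<kappa>3 where "\<kappa>3 = (\<lambda>N u. \<kappa>2 N (Ad (inverse (qpoch Q x4 N)) u))"
  have \<kappa>: "hom_seq \<kappa>1" "hom_seq \<kappa>2" "hom_seq \<kappa>3"
  proof -
    show 1: "hom_seq \<kappa>1"
      unfolding \<kappa>1_def by (rule hom_seq_Ad[OF hom_seq_id C(1)])
    show 2: "hom_seq \<kappa>2"
      unfolding \<kappa>2_def by (rule hom_seq_Ad[OF 1 C(2)])
    show "hom_seq \<kappa>3"
      unfolding \<kappa>3_def by (rule hom_seq_Ad[OF 2]) (use C in auto)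
  qed
  have X_commute: "x2 * X = X * x2" "x3 * X = X * x3" "x4 * X = X * x4"
    unfolding x2_def x3_def x4_def
    by (rule sym, rule commute_inverse commute_scale[OF _ zq] commute_scale[OF _ z],
        (rule commute_inverse)?, rule refl)+
  have \<kappa>x: "qfrac (\<lambda>N. \<kappa>1 N x2) x2" "qfrac (\<lambda>N. \<kappa>2 N x4) x4" "qfrac (\<lambda>N. \<kappa>3 N x3) x3"
    by (simp_all add: \<kappa>1_def \<kappa>2_def \<kappa>3_def Ad_X X_commute qfrac_const)
  have "qfrac (\<lambda>N. \<kappa>1 N w) ((1 + x1) * w)"
    unfolding \<kappa>1_def by (rule hom_seq_Ad_qpoch(1)[OF hom_seq_id 1 qfrac_const qfrac_const nz(1) x_nz(1)])
  then have "qfrac (\<lambda>N. \<kappa>2 N w) ((1 + x1) * w * inverse (1 + x2))"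
    unfolding \<kappa>2_def using one nz(1) x_nz by (intro hom_seq_Ad_qpoch'(1)[OF \<kappa>(1) 2 _ \<kappa>x(1)]) auto
  then have "qfrac (\<lambda>N. \<kappa>3 N w) ((1 + x1) * w * inverse (1 + x2) * (1 + x4))"
    unfolding \<kappa>3_def using one nz(1) x_nz by (intro hom_seq_Ad_qpoch'(2)[OF \<kappa>(2) 4 _ \<kappa>x(2)]) auto
  then have "qfrac (\<lambda>N. \<kappa>3 N (Ad (inverse (qpoch Q x3 N)) w))
      (inverse (1 + x3) * ((1 + x1) * w * inverse (1 + x2) * (1 + x4)))"
    using one nz(1) x_nz by (intro hom_seq_Ad_qpoch(2)[OF \<kappa>(3) 3 _ \<kappa>x(3)]) auto
  then have lim: "qfrac (\<lambda>N. Ad (Psi Q z X N) w) (inverse (1 + x3) * ((1 + x1) * w * inverse (1 + x2) * (1 + x4)))"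
    by (simp add: Ad_Psi \<kappa>1_def \<kappa>2_def \<kappa>3_def)
  show zX: "1 + z * X \<noteq> 0"
    by (rule q_commuting_not_central[OF wX nz(1,2) z])
  have Xx4: "X * (1 + x4) = X + z"
    using nz(2) by (simp add: distrib_left x4_def zc[of X])
  then show Xz: "X + z \<noteq> 0"
    using nz(2) one(4) by (metis no_zero_divisors)
  have "(1 + x1) * w = w * (1 + X)"
    by (simp add: distrib_left distrib_right x1_def wX)
  moreover have "1 + X = X * (1 + x2)"
    using nz(2) by (simp add: distrib_left x2_def)
  ultimately have "(1 + x1) * w * inverse (1 + x2) * (1 + x4) = w * (X + z)"
    using one(2) by (simp add: mult.assoc flip: Xx4)
  moreover have "w * (1 + z * X) = (1 + x3) * w"
    by (simp add: distrib_left distrib_right x3_def zc[of w] wX mult.assoc)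
  then have "inverse (1 + x3) * (w * (1 + z * X)) * inverse (1 + z * X) = w * inverse (1 + z * X)"
    using one(3) by (simp flip: mult.assoc)
  then have "inverse (1 + x3) * w = w * inverse (1 + z * X)"
    using zX by (simp add: mult.assoc)
  then have "inverse (1 + x3) * (w * (X + z)) = w * (inverse (1 + z * X) * (X + z))"
    by (simp flip: mult.assoc)
  moreover have "inverse (1 + z * X) * (X + z) = (X + z) * inverse (1 + z * X)"
  proof -
    have "(X + z) * X = X * (X + z)"
      using z[unfolded central_def, rule_format, of X] by (simp only: distrib_left distrib_right)
    then have "(X + z) * (z * X) = z * X * (X + z)"
      using z by (rule commute_scale)
    then have "(X + z) * (1 + z * X) = (1 + z * X) * (X + z)"
      by (simp only: distrib_left[of "X + z"] distrib_right[of _ _ "X + z"] mult_1_left mult_1_right)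
    then show ?thesis
      by (rule commute_inverse[symmetric])
  qed
  ultimately show "qfrac (\<lambda>N. Ad (Psi Q z X N) w) (w * ((X + z) * inverse (1 + z * X)))"
    using lim by simp
qed

end


section \<open>Exponentials of vector fields acting on the parameters\<close>

lemma is_ring_hom_of_int:
  assumes "is_ring_hom f"
  shows "f (of_int n) = of_int n"
proof -
  have nat: "f (of_nat m) = of_nat m" for m
    by (induction m) (simp_all add: is_ring_homD[OF assms])
  show ?thesis
    by (cases n) (simp_all add: nat is_ring_homD[OF assms] del: of_nat_Suc)
qed

lemma comm_eq_0: "comm x y = 0 \<longleftrightarrow> x * y = y * x"
  by (simp add: comm_def)

lemma comm_mult_left: "x * y = y * x \<Longrightarrow> comm (x * d) y = x * comm d y"
  by (simp add: comm_def right_diff_distrib mult.assoc) (simp flip: mult.assoc)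

lemma comm_scale_right: "d * x = x * d \<Longrightarrow> comm d (x * y) = x * comm d y"
  by (simp add: comm_def right_diff_distrib mult.assoc) (simp flip: mult.assoc)

lemma comm_diff_left: "comm (d - d') x = comm d x - comm d' x"
  by (simp add: comm_def algebra_simps)

lemma comm_sum_right: "comm d (\<Sum>i\<in>A. f i) = (\<Sum>i\<in>A. comm d (f i))"
  by (simp add: comm_def sum_distrib_left sum_distrib_right sum_subtractf)

locale quantum_letters = quantum_field Q for Q :: "('f::division_ring, 'b::ring_1) qdata" +
  assumes letters: "letters Q"
begin

abbreviation scb :: "complex \<Rightarrow> 'b" where
  "scb c \<equiv> emb Q (sc Q c)"

lemma emb_hom: "is_ring_hom (emb Q)"
  and al_commute: "j < 6 \<Longrightarrow> k < 6 \<Longrightarrow> al Q j * al Q k = al Q k * al Q j"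
  and al_emb: "j < 6 \<Longrightarrow> al Q j * emb Q \<phi> = emb Q \<phi> * al Q j"
  and dd_comm: "j < 6 \<Longrightarrow> comm (dd Q j) (scb c) = 0" "j < 6 \<Longrightarrow> comm (dd Q j) (emb Q (qq Q)) = 0"
    "j < 6 \<Longrightarrow> comm (dd Q j) (emb Q (FF Q)) = 0" "j < 6 \<Longrightarrow> comm (dd Q j) (emb Q (GG Q)) = 0"
    "j < 6 \<Longrightarrow> k < 6 \<Longrightarrow> comm (dd Q j) (al Q k) = of_int (cartan j k)"
  and dd'_comm: "j < 6 \<Longrightarrow> comm (dd' Q j) (scb c) = 0" "j < 6 \<Longrightarrow> comm (dd' Q j) (emb Q (qq Q)) = 0"
    "j < 6 \<Longrightarrow> comm (dd' Q j) (emb Q (FF Q)) = 0" "j < 6 \<Longrightarrow> comm (dd' Q j) (emb Q (GG Q)) = 0"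
    "j < 6 \<Longrightarrow> k < 6 \<Longrightarrow> comm (dd' Q j) (al Q k) = of_bool (j = k)"
  using letters unfolding letters_def by (simp_all add: comm_eq_0)

lemma scb_hom: "is_ring_hom scb"
  using is_ring_hom_comp[OF emb_hom sc_hom] by (simp add: o_def)

lemma scb_emb: "scb c * emb Q \<phi> = emb Q \<phi> * scb c"
  using sc_central by (simp add: central_def flip: is_ring_homD(3)[OF emb_hom])

lemma scb_of_int: "scb (of_int n) = of_int n"
  by (rule is_ring_hom_of_int[OF scb_hom])

lemma scb_sum: "scb (\<Sum>i\<in>A. f i) = (\<Sum>i\<in>A. scb (f i))"
  by (induction A rule: infinite_finite_induct) (simp_all add: is_ring_homD[OF scb_hom])

text \<open>The commutator with \<open>dd' Q k\<close> reads off the coefficient of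
  \<open>al Q k\<close>. This pins down the coefficients \<open>u\<close> and \<open>n\<close> that
  \<open>is_exp\<close> only asserts to exist.\<close>

lemma al_coefficients_unique:
  assumes "(\<Sum>l<6. scb (u l) * al Q l) = (\<Sum>l<6. scb (v l) * al Q l)" "k < 6"
  shows "u k = v k"
proof -
  have "comm (dd' Q k) (\<Sum>l<6. scb (u l) * al Q l) = scb (u k)" for u
  proof -
    have "comm (dd' Q k) (\<Sum>l<6. scb (u l) * al Q l) = (\<Sum>l<6. scb (u l) * of_bool (k = l))"
      unfolding comm_sum_right
      using dd'_comm(1,5) assms(2) by (intro sum.cong) (auto simp: comm_scale_right comm_eq_0)
    also have "\<dots> = (\<Sum>l<6. if l = k then scb (u k) else 0)"
      by (intro sum.cong) auto
    finally show ?thesis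
      using assms(2) by simp
  qed
  from this[of u] this[of v] have "scb (u k) = scb (v k)"
    by (simp add: assms(1))
  then show ?thesis
    using is_ring_hom_inj[OF scb_hom] by blast
qed

text \<open>A vector field \<open>(\<pi>i/2) V d\<close> with \<open>[d, V] = 2\<close> exponentiates to the reflection
  \<open>x \<mapsto> x - [d, x] V\<close>, because \<open>exp (\<pi>i) = - 1\<close>.\<close>

lemma is_exp_reflection:
  fixes b v :: "nat \<Rightarrow> int"
  assumes E: "is_exp Q D E" and c: "c = complex_of_real (pi / 2) * \<i>"
    and V: "V = (\<Sum>l<6. of_int (v l) * al Q l)"
    and D_al: "\<And>l. l < 6 \<Longrightarrow> comm D (al Q l) = scb c * (of_int (b l) * V)"
    and D_sc: "\<And>x. comm D (scb x) = 0"
    and two: "(\<Sum>l<6. b l * v l) = 2" and k: "k < 6"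
  shows "Ad E (emb Q (aa Q k)) = emb Q (mono_a Q (\<lambda>l. (if l = k then 1 else 0) - b k * v l))"
proof -
  note hom = is_ring_homD[OF scb_hom]
  have D_scale: "comm D (scb x * y) = scb x * comm D y" for x y
    using D_sc by (simp add: comm_scale_right comm_eq_0)
  have D_al': "comm D (al Q l) = scb (c * of_int (b l)) * V" if "l < 6" for l
    using D_al[OF that] by (simp add: hom scb_of_int mult.assoc)
  have V': "V = (\<Sum>l<6. scb (of_int (v l)) * al Q l)"
    by (simp add: V scb_of_int)
  have "comm D V = (\<Sum>l<6. scb (of_int (v l) * (c * of_int (b l))) * V)"
    unfolding V' comm_sum_right by (intro sum.cong refl) (simp add: D_scale D_al' hom mult.assoc flip: V')
  also have "\<dots> = scb (\<Sum>l<6. of_int (v l) * (c * of_int (b l))) * V"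
    by (simp add: scb_sum sum_distrib_right)
  also have "(\<Sum>l<6. of_int (v l) * (c * of_int (b l))) = c * of_int (\<Sum>l<6. b l * v l)"
    by (simp add: sum_distrib_left mult_ac)
  \<comment> \<open>\<open>V\<close> is an eigenvector with eigenvalue \<open>2 * c\<close>, that
    is, \<open>pi\<close> times the imaginary unit. After one step every iterated commutator of
    \<open>al Q k\<close> is a multiple of \<open>V\<close>.\<close>
  finally have D_V: "comm D V = scb (2 * c) * V"
    by (simp add: two mult.commute)
  have iter: "(comm D ^^ Suc m) (al Q k) = scb (c * of_int (b k) * (2 * c) ^ m) * V" for m
  proof (induction m)
    case 0
    then show ?case
      using D_al'[OF k] by simp
  next
    case (Suc m)
    have "(comm D ^^ Suc (Suc m)) (al Q k) = comm D (scb (c * of_int (b k) * (2 * c) ^ m) * V)"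
      using Suc.IH by simp
    also have "\<dots> = scb (c * of_int (b k) * (2 * c) ^ m) * (scb (2 * c) * V)"
      by (simp only: D_scale D_V)
    also have "\<dots> = scb (c * of_int (b k) * (2 * c) ^ Suc m) * V"
      by (simp only: hom(3)[symmetric] mult.assoc[symmetric] power_Suc2)
    finally show ?case .
  qed
  from E k obtain u n where u: "\<And>m. (comm D ^^ m) (al Q k) = (\<Sum>l<6. scb (u m l) * al Q l)"
    and n: "\<And>l. l < 6 \<Longrightarrow> (\<lambda>m. u m l / fact m) sums of_int (n l)"
    and Ad: "Ad E (emb Q (aa Q k)) = emb Q (mono_a Q n)"
    unfolding is_exp_def by blast
  have u0: "u 0 l = (if l = k then 1 else 0)" if "l < 6" for l
  proof (rule al_coefficients_unique[OF _ that])
    have "(\<Sum>l<6. scb (if l = k then 1 else 0) * al Q l) = (\<Sum>l<6. if l = k then al Q k else 0)"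
      by (intro sum.cong) (auto simp: hom)
    then show "(\<Sum>l<6. scb (u 0 l) * al Q l) = (\<Sum>l<6. scb (if l = k then 1 else 0) * al Q l)"
      using u[of 0] k by simp
  qed
  have uS: "u (Suc m) l = c * of_int (b k) * (2 * c) ^ m * of_int (v l)" if "l < 6" for m l
  proof (rule al_coefficients_unique[OF _ that])
    show "(\<Sum>l<6. scb (u (Suc m) l) * al Q l) =
        (\<Sum>l<6. scb (c * of_int (b k) * (2 * c) ^ m * of_int (v l)) * al Q l)"
      unfolding u[symmetric] iter V' sum_distrib_left by (simp only: hom(3) mult.assoc)
  qed
  have "n l = (if l = k then 1 else 0) - b k * v l" if l: "l < 6" for l
  proof -
    \<comment> \<open>For \<open>m \<ge> 1\<close> the coefficient
      \<open>c * b k * (2 * c) ^ (m - 1) * v l\<close> equals \<open>e * (2 * c) ^ m\<close>. So the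
      series is \<open>e\<close> times the exponential series, except that its term at
      \<open>m = 0\<close> is \<open>d\<close> instead of \<open>e\<close>.\<close>
    define e where "e = (of_int (b k * v l) / 2 :: complex)"
    define d where "d = (if l = k then 1 else 0 :: complex)"
    have "(\<lambda>m. e * ((2 * c) ^ m /\<^sub>R fact m)) sums (e * exp (2 * c))"
      by (intro sums_mult exp_converges)
    moreover have "(\<lambda>m. if m = 0 then d - e else 0) sums (d - e)"
      using sums_single[of 0 "\<lambda>_. d - e"] by simp
    ultimately have "(\<lambda>m. e * ((2 * c) ^ m /\<^sub>R fact m) + (if m = 0 then d - e else 0)) sums (e * exp (2 * c) + (d - e))"
      by (rule sums_add)
    moreover have "u m l / fact m = e * ((2 * c) ^ m /\<^sub>R fact m) + (if m = 0 then d - e else 0)" for m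
    proof (cases m)
      case 0
      then show ?thesis
        by (simp add: u0 l d_def)
    next
      case (Suc m')
      then show ?thesis
        by (simp add: uS l e_def scaleR_conv_of_real field_simps del: fact_Suc)
    qed
    ultimately have "(\<lambda>m. u m l / fact m) sums (e * exp (2 * c) + (d - e))"
      by simp
    then have "of_int (n l) = e * exp (2 * c) + (d - e)"
      using n[OF l] sums_unique2 by blast
    also have "exp (2 * c) = - 1"
      by (simp add: c mult.assoc flip: exp_pi_i)
    finally have "of_int (n l) = d - 2 * e"
      by simp
    also have "\<dots> = of_int ((if l = k then 1 else 0) - b k * v l)"
      by (simp add: d_def e_def)
    finally show ?thesis
      by (simp only: of_int_eq_iff)
  qed
  then have "mono_a Q n = mono_a Q (\<lambda>l. (if l = k then 1 else 0) - b k * v l)"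
    unfolding mono_a_def by (intro arg_cong[of _ _ prod_list] map_cong) auto
  with Ad show ?thesis
    by simp
qed

section \<open>Elements of the overring whose conjugation preserves the skew field\<close>

definition implements :: "'b \<Rightarrow> ('f \<Rightarrow> 'f) \<Rightarrow> bool" where
  "implements X \<tau> \<longleftrightarrow> is_unit_of X \<and> is_ring_hom \<tau> \<and> (\<forall>\<phi>. Ad X (emb Q \<phi>) = emb Q (\<tau> \<phi>))"

lemma implements_mult: "implements X \<tau> \<Longrightarrow> implements Y \<upsilon> \<Longrightarrow> implements (X * Y) (\<tau> \<circ> \<upsilon>)"
  by (simp add: implements_def is_unit_of_mult Ad_mult is_ring_hom_comp)

lemma implements_emb:
  assumes "x \<noteq> 0"
  shows "implements (emb Q x) (Ad x)"
proof -
  have inv: "emb Q x * emb Q (inverse x) = 1" "emb Q (inverse x) * emb Q x = 1"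
    using assms by (simp_all add: is_ring_homD(1)[OF emb_hom] flip: is_ring_homD(3)[OF emb_hom])
  then have "is_unit_of (emb Q x)"
    by (auto simp: is_unit_of_def)
  moreover have "is_ring_hom (Ad x)"
    using assms by (intro is_ring_hom_Ad) (simp add: is_unit_of_division)
  ultimately show ?thesis
    using assms inv
    by (simp add: implements_def Ad_def unit_inv_eq unit_inv_division is_ring_homD(3)[OF emb_hom])
qed

lemma implements_fixed: "implements X \<tau> \<Longrightarrow> Ad X (emb Q \<phi>) = emb Q \<psi> \<Longrightarrow> \<tau> \<phi> = \<psi>"
  using is_ring_hom_inj[OF emb_hom] by (auto simp: implements_def)

lemma implements_exists:
  assumes X: "is_unit_of X"
    and gen: "\<And>c. Ad X (scb c) \<in> range (emb Q)" "Ad X (emb Q (qq Q)) \<in> range (emb Q)"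
      "\<And>k. k < 6 \<Longrightarrow> Ad X (emb Q (aa Q k)) \<in> range (emb Q)"
      "Ad X (emb Q (FF Q)) \<in> range (emb Q)" "Ad X (emb Q (GG Q)) \<in> range (emb Q)"
  obtains \<tau> where "implements X \<tau>"
proof -
  note Ad_hom = is_ring_homD[OF is_ring_hom_Ad[OF X]]
  note hom = is_ring_homD[OF emb_hom]
  have "Ad X (emb Q \<phi>) \<in> range (emb Q)" for \<phi>
  proof (induction \<phi> rule: skew_field_induct)
    case (inverse x)
    then obtain \<psi> where \<psi>: "Ad X (emb Q x) = emb Q \<psi>"
      by auto
    \<comment> \<open>The overring need not be a division ring, so the inverse has to be located
      inside the skew field: \<open>\<psi>\<close> is nonzero because its image is a unit, and
      uniqueness of inverses gives \<open>emb Q (inverse \<psi>)\<close>.\<close>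
    have 1: "Ad X (emb Q (inverse x)) * emb Q \<psi> = 1"
      unfolding \<psi>[symmetric] Ad_hom(3)[symmetric] hom(3)[symmetric]
      using inverse(2) by (simp add: hom(1) Ad_hom(1))
    then have "\<psi> \<noteq> 0"
      using hom(4) by auto
    then have "emb Q \<psi> * emb Q (inverse \<psi>) = 1"
      unfolding hom(3)[symmetric] by (simp add: hom(1))
    then have "Ad X (emb Q (inverse x)) = (Ad X (emb Q (inverse x)) * emb Q \<psi>) * emb Q (inverse \<psi>)"
      by (simp add: mult.assoc)
    then show ?case
      by (simp add: 1)
  next
    case (add x y)
    then obtain \<psi> \<xi> where "Ad X (emb Q x) = emb Q \<psi>" "Ad X (emb Q y) = emb Q \<xi>"
      by auto
    then have "Ad X (emb Q (x + y)) = emb Q (\<psi> + \<xi>)"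
      by (simp add: hom(2) Ad_hom(2))
    then show ?case
      by simp
  next
    case (mult x y)
    then obtain \<psi> \<xi> where "Ad X (emb Q x) = emb Q \<psi>" "Ad X (emb Q y) = emb Q \<xi>"
      by auto
    then have "Ad X (emb Q (x * y)) = emb Q (\<psi> * \<xi>)"
      by (simp add: hom(3) Ad_hom(3))
    then show ?case
      by simp
  qed (fact gen)+
  then have "\<forall>\<phi>. \<exists>\<psi>. Ad X (emb Q \<phi>) = emb Q \<psi>"
    by blast
  then obtain \<tau> where \<tau>: "\<And>\<phi>. Ad X (emb Q \<phi>) = emb Q (\<tau> \<phi>)"
    by (auto dest!: choice)
  have "is_ring_hom \<tau>"
    unfolding is_ring_hom_def
    by (intro conjI allI; rule is_ring_hom_inj[OF emb_hom]) (simp_all add: hom Ad_hom flip: \<tau>)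
  then have "implements X \<tau>"
    using X \<tau> by (simp add: implements_def)
  then show thesis
    by (rule that)
qed

lemma is_exp_implements:
  assumes E: "is_exp Q D E"
    and D: "\<And>c. comm D (scb c) = 0" "comm D (emb Q (qq Q)) = 0" "comm D (emb Q (FF Q)) = 0"
      "comm D (emb Q (GG Q)) = 0"
    and a: "\<And>k. k < 6 \<Longrightarrow> Ad E (emb Q (aa Q k)) = emb Q (a' k)"
  obtains \<tau> where "implements E \<tau>" "\<And>c. \<tau> (sc Q c) = sc Q c" "\<tau> (qq Q) = qq Q" "\<tau> (FF Q) = FF Q"
    "\<tau> (GG Q) = GG Q" "\<And>k. k < 6 \<Longrightarrow> \<tau> (aa Q k) = a' k"
proof -
  have unit: "is_unit_of E"
    using E by (simp add: is_exp_def)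
  have fixed: "Ad E (emb Q \<phi>) = emb Q \<phi>" if "comm D (emb Q \<phi>) = 0" for \<phi>
    using E that by (intro Ad_commute) (auto simp: is_exp_def comm_eq_0)
  obtain \<tau> where "implements E \<tau>"
    by (rule implements_exists[OF unit]) (auto simp: fixed D a)
  then show thesis
    using that implements_fixed[of E \<tau>] fixed D a by blast
qed

end


section \<open>Laurent monomials in the parameters\<close>

lemma prod_list_mult_central:
  fixes f g :: "'i \<Rightarrow> 'r::ring_1"
  assumes "\<And>k. k \<in> set xs \<Longrightarrow> central (g k)"
  shows "prod_list (map (\<lambda>k. f k * g k) xs) = prod_list (map f xs) * prod_list (map g xs)"
  using assms
proof (induction xs)
  case (Cons k xs)
  have "f k * g k * (prod_list (map f xs) * prod_list (map g xs)) =
      f k * (g k * prod_list (map f xs)) * prod_list (map g xs)"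
    by (simp only: mult.assoc)
  also have "g k * prod_list (map f xs) = prod_list (map f xs) * g k"
    using Cons.prems[of k] by (simp add: central_def)
  finally show ?case
    using Cons by (simp add: mult.assoc)
qed simp

context quantum_field
begin

lemma central_power_int: "central x \<Longrightarrow> central (x powi n)" for x :: 'f
  by (simp add: power_int_def central_intros)

lemma mono_a_add: "mono_a Q (\<lambda>l. n l + m l) = mono_a Q n * mono_a Q m"
proof -
  have "mono_a Q (\<lambda>l. n l + m l) = prod_list (map (\<lambda>k. aa Q k powi n k * aa Q k powi m k) [0..<6])"
    unfolding mono_a_def by (intro arg_cong[of _ _ prod_list] map_cong refl power_int_add) (simp add: a_nonzero)
  also have "\<dots> = mono_a Q n * mono_a Q m"
    unfolding mono_a_def by (rule prod_list_mult_central) (simp add: central_power_int aa_central)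
  finally show ?thesis .
qed

lemma mono_a_delta: "k < 6 \<Longrightarrow> mono_a Q (\<lambda>l. if l = k then 1 else 0) = aa Q k"
  by (simp add: mono_a_single)

end

context quantum_letters
begin

section \<open>The exponential factors acting on the parameters\<close>

lemma comm_emb_mult:
  assumes "i < 6" "comm d (emb Q \<phi>) = 0"
  shows "comm (scb c * al Q i * d) (emb Q \<phi>) = 0"
proof -
  have "scb c * al Q i * emb Q \<phi> = emb Q \<phi> * (scb c * al Q i)"
    by (simp only: mult.assoc al_emb[OF assms(1)]) (simp only: scb_emb flip: mult.assoc)
  then show ?thesis
    by (simp add: comm_mult_left assms(2))
qed

text \<open>An instance of the reflection lemma with \<open>V = al Q j\<close> and
  \<open>b = cartan j\<close>; its normalisation is the diagonal entry \<open>2\<close> of the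
  Cartan matrix. The result is the parameter part of the simple reflection
  \<open>s j\<close>.\<close>

lemma rho_implements:
  assumes j: "j < 6" and E: "is_exp Q (D_rho Q j) E"
  obtains \<tau> where "implements E \<tau>" "\<And>c. \<tau> (sc Q c) = sc Q c" "\<tau> (qq Q) = qq Q" "\<tau> (FF Q) = FF Q"
    "\<tau> (GG Q) = GG Q" "\<And>k. k < 6 \<Longrightarrow> \<tau> (aa Q k) = aa Q j powi (- cartan j k) * aa Q k"
proof (rule is_exp_implements[OF E])
  have V: "al Q j = (\<Sum>l<6. of_int (if l = j then 1 else 0) * al Q l)"
  proof -
    have "(\<Sum>l<6. of_int (if l = j then 1 else 0) * al Q l) = (\<Sum>l<6. if l = j then al Q j else 0)"
      by (intro sum.cong) auto
    with j show ?thesis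
      by simp
  qed
  have D_al: "comm (D_rho Q j) (al Q l) = scb (complex_of_real (pi / 2) * \<i>) * (of_int (cartan j l) * al Q j)"
    if "l < 6" for l
  proof -
    have "scb c * al Q j * al Q l = al Q l * (scb c * al Q j)" for c
    proof -
      have "al Q l * (scb c * al Q j) = scb c * (al Q l * al Q j)"
        by (simp only: al_emb[OF that] flip: mult.assoc)
      then show ?thesis
        by (simp only: al_commute[OF j that] mult.assoc)
    qed
    then have "comm (D_rho Q j) (al Q l) = scb (complex_of_real (pi / 2) * \<i>) * al Q j * of_int (cartan j l)"
      unfolding D_rho_def using that j by (simp add: comm_mult_left dd_comm)
    then show ?thesis
      by (simp only: mult.assoc mult_of_int_commute)
  qed
  have zero: "comm (D_rho Q j) (emb Q \<phi>) = 0" if "comm (dd Q j) (emb Q \<phi>) = 0" for \<phi>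
    unfolding D_rho_def by (rule comm_emb_mult[OF j that])
  show "comm (D_rho Q j) (scb c) = 0" for c
    by (rule zero[OF dd_comm(1)[OF j]])
  then show "Ad E (emb Q (aa Q k)) = emb Q (aa Q j powi (- cartan j k) * aa Q k)" if "k < 6" for k
  proof -
    have two: "(\<Sum>l<6. cartan j l * (if l = j then 1 else 0)) = 2"
    proof -
      have "(\<Sum>l<6. cartan j l * (if l = j then 1 else 0)) = (\<Sum>l<6. if l = j then 2 else 0)"
        by (intro sum.cong) (auto simp: cartan_def)
      with j show ?thesis
        by simp
    qed
    have "Ad E (emb Q (aa Q k)) = emb Q (mono_a Q (\<lambda>l. (if l = k then 1 else 0) - cartan j k * (if l = j then 1 else 0)))"
      by (rule is_exp_reflection[OF E refl V D_al zero[OF dd_comm(1)[OF j]] two that])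
    also have "(\<lambda>l. (if l = k then 1 else 0) - cartan j k * (if l = j then 1 else 0)) =
        (\<lambda>l. (if l = j then - cartan j k else 0) + (if l = k then 1 else 0))"
      by auto
    also have "mono_a Q \<dots> = aa Q j powi (- cartan j k) * aa Q k"
      using j that by (simp add: mono_a_add mono_a_single mono_a_delta)
    finally show ?thesis .
  qed
  show "comm (D_rho Q j) (emb Q (qq Q)) = 0"
    by (rule zero[OF dd_comm(2)[OF j]])
  show "comm (D_rho Q j) (emb Q (FF Q)) = 0"
    by (rule zero[OF dd_comm(3)[OF j]])
  show "comm (D_rho Q j) (emb Q (GG Q)) = 0"
    by (rule zero[OF dd_comm(4)[OF j]])
qed (rule that)

lemma swap_implements:
  assumes ij: "i < 6" "j < 6" "i \<noteq> j" and E: "is_exp Q (D_swap Q i j) E"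
  obtains \<tau> where "implements E \<tau>" "\<And>c. \<tau> (sc Q c) = sc Q c" "\<tau> (qq Q) = qq Q" "\<tau> (FF Q) = FF Q"
    "\<tau> (GG Q) = GG Q" "\<And>k. k < 6 \<Longrightarrow> \<tau> (aa Q k) = aa Q (if k = i then j else if k = j then i else k)"
proof (rule is_exp_implements[OF E])
  \<comment> \<open>\<open>b\<close> plays both roles in the reflection lemma: it lists the
    coefficients of \<open>V = al Q i - al Q j\<close> and the commutators of
    \<open>dd' Q i - dd' Q j\<close> with the letters. The reflection in this vector is the
    transposition of \<open>i\<close> and \<open>j\<close>.\<close>
  define b where "b l = (if l = i then 1 else if l = j then - 1 else 0 :: int)" for l :: nat
  have V: "al Q i - al Q j = (\<Sum>l<6. of_int (b l) * al Q l)"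
  proof -
    have "(\<Sum>l<6. of_int (b l) * al Q l) = (\<Sum>l<6. (if l = i then al Q i else 0) - (if l = j then al Q j else 0))"
      using ij(3) by (intro sum.cong) (auto simp: b_def)
    with ij show ?thesis
      by (simp add: sum_subtractf)
  qed
  have D_al: "comm (D_swap Q i j) (al Q l) = scb (complex_of_real (pi / 2) * \<i>) * (of_int (b l) * (al Q i - al Q j))"
    if "l < 6" for l
  proof -
    have "al Q l * (al Q i - al Q j) = (al Q i - al Q j) * al Q l"
      using al_commute[OF ij(1) that] al_commute[OF ij(2) that] by (simp add: left_diff_distrib right_diff_distrib)
    then have "scb c * (al Q i - al Q j) * al Q l = al Q l * (scb c * (al Q i - al Q j))" for c
    proof -
      have "al Q l * (scb c * (al Q i - al Q j)) = scb c * (al Q l * (al Q i - al Q j))"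
        by (simp only: al_emb[OF that] flip: mult.assoc)
      then show ?thesis
        by (simp only: \<open>al Q l * (al Q i - al Q j) = _\<close> mult.assoc)
    qed
    moreover have "comm (dd' Q i - dd' Q j) (al Q l) = of_int (b l)"
      using ij that by (auto simp: comm_diff_left dd'_comm b_def)
    ultimately have "comm (D_swap Q i j) (al Q l) = scb (complex_of_real (pi / 2) * \<i>) * (al Q i - al Q j) * of_int (b l)"
      unfolding D_swap_def by (simp add: comm_mult_left)
    then show ?thesis
      by (simp only: mult.assoc mult_of_int_commute)
  qed
  have zero: "comm (D_swap Q i j) (emb Q \<phi>) = 0"
    if "comm (dd' Q i) (emb Q \<phi>) = 0" "comm (dd' Q j) (emb Q \<phi>) = 0" for \<phi>
  proof -
    have 0: "comm (dd' Q i - dd' Q j) (emb Q \<phi>) = 0"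
      by (simp add: comm_diff_left that)
    have "D_swap Q i j = scb (complex_of_real (pi / 2) * \<i>) * al Q i * (dd' Q i - dd' Q j)
        - scb (complex_of_real (pi / 2) * \<i>) * al Q j * (dd' Q i - dd' Q j)"
      by (simp add: D_swap_def right_diff_distrib left_diff_distrib)
    then show ?thesis
      using comm_emb_mult[OF ij(1) 0] comm_emb_mult[OF ij(2) 0] by (simp add: comm_diff_left)
  qed
  show sc: "comm (D_swap Q i j) (scb c) = 0" for c
    by (rule zero[OF dd'_comm(1)[OF ij(1)] dd'_comm(1)[OF ij(2)]])
  show "comm (D_swap Q i j) (emb Q (qq Q)) = 0"
    by (rule zero[OF dd'_comm(2)[OF ij(1)] dd'_comm(2)[OF ij(2)]])
  show "comm (D_swap Q i j) (emb Q (FF Q)) = 0"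
    by (rule zero[OF dd'_comm(3)[OF ij(1)] dd'_comm(3)[OF ij(2)]])
  show "comm (D_swap Q i j) (emb Q (GG Q)) = 0"
    by (rule zero[OF dd'_comm(4)[OF ij(1)] dd'_comm(4)[OF ij(2)]])
  show "Ad E (emb Q (aa Q k)) = emb Q (aa Q (if k = i then j else if k = j then i else k))" if "k < 6" for k
  proof -
    have "(\<Sum>l<6. b l * b l) = (\<Sum>l<6. (if l = i then 1 else 0) + (if l = j then 1 else 0))"
      using ij(3) by (intro sum.cong) (auto simp: b_def)
    then have two: "(\<Sum>l<6. b l * b l) = 2"
      using ij by (simp add: sum.distrib)
    have "Ad E (emb Q (aa Q k)) = emb Q (mono_a Q (\<lambda>l. (if l = k then 1 else 0) - b k * b l))"
      by (rule is_exp_reflection[OF E refl V D_al sc two that])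
    also have "(\<lambda>l. (if l = k then 1 else 0) - b k * b l) =
        (\<lambda>l. if l = (if k = i then j else if k = j then i else k) then 1 else 0)"
      using ij(3) by (auto simp: b_def)
    also have "mono_a Q \<dots> = aa Q (if k = i then j else if k = j then i else k)"
      by (rule mono_a_delta) (use ij that in auto)
    finally show ?thesis .
  qed
qed (rule that)

text \<open>Unlike \<open>Ad_lim\<close>, which concerns one element at a time, this notion is
  closed under products of sequences, which is what a product of nine factors requires.\<close>

definition Ad_tendsto :: "(nat \<Rightarrow> 'b) \<Rightarrow> ('f \<Rightarrow> 'f) \<Rightarrow> bool" where
  "Ad_tendsto X t \<longleftrightarrow> (\<exists>\<tau>. (\<forall>N. implements (X N) (\<tau> N)) \<and> conv_homs \<tau> t)"

lemma Ad_tendsto_mult: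
  assumes "Ad_tendsto X t" "Ad_tendsto Y u"
  shows "Ad_tendsto (\<lambda>N. X N * Y N) (t \<circ> u)"
proof -
  obtain \<tau> \<upsilon> where "\<And>N. implements (X N) (\<tau> N)" "conv_homs \<tau> t"
    "\<And>N. implements (Y N) (\<upsilon> N)" "conv_homs \<upsilon> u"
    using assms unfolding Ad_tendsto_def by blast
  then show ?thesis
    unfolding Ad_tendsto_def
    by (intro exI[of _ "\<lambda>N. \<tau> N \<circ> \<upsilon> N"]) (simp add: implements_mult conv_homs_comp)
qed

lemma Ad_tendsto_imp_Ad_lim:
  assumes "Ad_tendsto X t"
  shows "Ad_lim Q X \<phi> (t \<phi>)"
proof -
  obtain \<tau> where \<tau>: "\<And>N. implements (X N) (\<tau> N)" "conv_homs \<tau> t"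
    using assms unfolding Ad_tendsto_def by blast
  then have "q_lim Q (\<lambda>N. \<tau> N \<phi>) (t \<phi>)"
    by (intro qfrac_imp_q_lim) (simp add: conv_homs_def)
  with \<tau>(1) show ?thesis
    unfolding Ad_lim_def implements_def by (intro conjI exI[of _ "\<lambda>N. \<tau> N \<phi>"]) simp_all
qed

section \<open>Limits of the conjugations by the individual factors of the Hamiltonian\<close>

lemma Ad_central: "x \<noteq> 0 \<Longrightarrow> central y \<Longrightarrow> Ad x y = y" for x y :: 'f
  by (rule Ad_commute) (simp_all add: is_unit_of_division central_def)

text \<open>The two factors divide the work: \<open>\<rho> j\<close> fixes \<open>F\<close> and
  \<open>G\<close> and reflects the parameters, while conjugation by \<open>Psi\<close> fixes the
  central parameters and moves only \<open>F\<close> (for \<open>j = 2\<close>) or \<open>G\<close>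
  (for \<open>j = 3\<close>).\<close>

lemma SS_Ad_tendsto:
  assumes s: "weyl_action Q s" and j: "j < 6" and \<rho>: "is_exp Q (D_rho Q j) (\<rho> j)"
  shows "Ad_tendsto (SS Q \<rho> j) (s j)"
proof -
  from rho_implements[OF j \<rho>] obtain r where r: "implements (\<rho> j) r" "\<And>c. r (sc Q c) = sc Q c"
    "r (qq Q) = qq Q" "r (FF Q) = FF Q" "r (GG Q) = GG Q"
    "\<And>k. k < 6 \<Longrightarrow> r (aa Q k) = aa Q j powi (- cartan j k) * aa Q k"
    by blast
  have s_hom: "is_ring_hom (s j)" and s_fixed: "\<And>c. s j (sc Q c) = sc Q c" "s j (qq Q) = qq Q"
    and s_a: "\<And>k. k < 6 \<Longrightarrow> s j (aa Q k) = aa Q j powi (- cartan j k) * aa Q k"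
    and s_F: "j \<noteq> 2 \<Longrightarrow> s j (FF Q) = FF Q" and s_G: "j \<noteq> 3 \<Longrightarrow> s j (GG Q) = GG Q"
    using s j by (auto simp: weyl_action_def is_ring_automorphism_def)
  have a_central: "central (aa Q j powi (- cartan j k) * aa Q k)" if "k < 6" for k
    using that j by (intro central_intros central_power_int aa_central)
  have product: "Ad_tendsto (\<lambda>N. emb Q (P N) * \<rho> j) (s j)"
    if P: "\<And>N. P N \<noteq> 0" "qfrac (\<lambda>N. Ad (P N) (FF Q)) (s j (FF Q))" "qfrac (\<lambda>N. Ad (P N) (GG Q)) (s j (GG Q))"
    for P
  proof -
    have impl: "implements (emb Q (P N) * \<rho> j) (Ad (P N) \<circ> r)" for N
      by (rule implements_mult[OF implements_emb[OF P(1)] r(1)])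
    have "conv_homs (\<lambda>N. Ad (P N) \<circ> r) (s j)"
    proof (rule conv_homsI)
      show "is_ring_hom (Ad (P N) \<circ> r)" for N
        using impl by (simp add: implements_def)
    qed (use P r s_hom s_fixed s_a a_central in \<open>simp_all add: Ad_central sc_central qq_central qfrac_const\<close>)
    with impl show ?thesis
      unfolding Ad_tendsto_def by (intro exI[of _ "\<lambda>N. Ad (P N) \<circ> r"]) simp
  qed
  consider "j = 2" | "j = 3" | "j \<noteq> 2" "j \<noteq> 3"
    by blast
  then show ?thesis
  proof cases
    case 1
    define c where "c = aa Q 0 * inverse (aa Q 1)"
    have cz: "central c" "c \<noteq> 0" "central (aa Q 2 ^ 2)" "aa Q 2 ^ 2 \<noteq> 0"
      by (simp_all add: c_def central_intros aa_central a_nonzero)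
    have FX: "FF Q * (c * GG Q) = qq Q * (c * GG Q) * FF Q"
      by (rule q_commuting_scale[OF FG_commutation cz(1)])
    have "c * GG Q \<noteq> 0"
      using cz G_nonzero by simp
    note Psi = Psi_limit[OF FX F_nonzero this cz(4,3)]
    have "s j (FF Q) = FF Q * ((c * GG Q + aa Q 2 ^ 2) * inverse (1 + aa Q 2 ^ 2 * (c * GG Q)))"
    proof -
      have "aa Q 2 ^ 2 * (c * GG Q) = c * aa Q 2 ^ 2 * GG Q"
        using cz(1) by (simp add: central_def mult.assoc)
      then show ?thesis
        using s 1 by (simp add: weyl_action_def divide_inverse c_def add.commute)
    qed
    moreover have "Ad (Psi Q (aa Q 2 ^ 2) (c * GG Q) N) (GG Q) = GG Q" for N
      by (rule Psi(3)) (rule commute_scale[OF refl cz(1)])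
    ultimately have "Ad_tendsto (\<lambda>N. emb Q (Psi Q (aa Q 2 ^ 2) (c * GG Q) N) * \<rho> j) (s j)"
      using Psi(1,2) 1 s_G by (intro product) (simp_all add: qfrac_const)
    then show ?thesis
      unfolding SS_def using 1 by (simp add: c_def)
  next
    case 2
    define c where "c = aa Q 4 * inverse (aa Q 5)"
    define z where "z = aa Q 3 ^ 2"
    have cz: "central c" "c \<noteq> 0" "central z" "z \<noteq> 0"
      by (simp_all add: c_def z_def central_intros aa_central a_nonzero)
    \<comment> \<open>It is \<open>inverse G\<close>, not \<open>G\<close>, that satisfies the
      relation demanded by \<open>Psi_limit\<close> with respect to \<open>F\<close>. The limit is
      computed for \<open>inverse G\<close> and then inverted, which also puts the fraction to the
      left of \<open>G\<close>.\<close>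
    have "inverse (GG Q) * FF Q = qq Q * FF Q * inverse (GG Q)"
      by (rule q_commuting_inverse[OF FG_commutation G_nonzero])
    then have GX: "inverse (GG Q) * (c * FF Q) = qq Q * (c * FF Q) * inverse (GG Q)"
      using cz(1) by (rule q_commuting_scale)
    have "inverse (GG Q) \<noteq> 0" "c * FF Q \<noteq> 0"
      using cz G_nonzero F_nonzero by simp_all
    note Psi = Psi_limit[OF GX this cz(4,3)]
    have "qfrac (\<lambda>N. inverse (Ad (Psi Q z (c * FF Q) N) (inverse (GG Q))))
        (inverse (inverse (GG Q) * ((c * FF Q + z) * inverse (1 + z * (c * FF Q)))))"
      using Psi(2,4,5) G_nonzero by (intro qfrac_inverse) auto
    moreover have "inverse (Ad (Psi Q z (c * FF Q) N) (inverse (GG Q))) = Ad (Psi Q z (c * FF Q) N) (GG Q)" for N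
      using Psi(1) by (simp add: is_ring_hom_inverse[OF is_ring_hom_Ad] is_unit_of_division)
    moreover have "inverse (inverse (GG Q) * ((c * FF Q + z) * inverse (1 + z * (c * FF Q)))) = s j (GG Q)"
      using s 2 Psi(4,5) G_nonzero
      by (simp add: weyl_action_def divide_inverse c_def z_def add.commute mult.assoc nonzero_inverse_mult_distrib)
    moreover have "Ad (Psi Q z (c * FF Q) N) (FF Q) = FF Q" for N
      by (rule Psi(3)) (rule commute_scale[OF refl cz(1)])
    ultimately have "Ad_tendsto (\<lambda>N. emb Q (Psi Q z (c * FF Q) N) * \<rho> j) (s j)"
      using Psi(1) 2 s_F by (intro product) (simp_all add: qfrac_const)
    then show ?thesis
      unfolding SS_def using 2 by (simp add: c_def z_def)
  next
    case 3
    then show ?thesis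
      using product[of "\<lambda>N. 1"] s_F s_G
      by (simp add: SS_def[abs_def] Ad_central is_ring_homD[OF emb_hom] qfrac_const Ad_commute is_unit_of_division)
  qed
qed

text \<open>Each theta factor multiplies a suitable generator by the current image of its argument,
  so all limits are monomials. The first gives \<open>F \<mapsto> F * F * G\<close> and
  \<open>inverse G \<mapsto> q * F\<close>; the second changes \<open>F\<close> to
  \<open>inverse (q * F)\<close> and fixes its own argument \<open>inverse G * F\<close>; the
  remaining four affect only \<open>G\<close>.\<close>

lemma Ad_theta_limits:
  defines "\<Theta> \<equiv> \<lambda>N. theta Q (qq Q * FF Q * GG Q) N * theta Q (inverse (GG Q) * FF Q) N * theta Q (qq Q * FF Q) N ^ 4"
  shows "\<Theta> N \<noteq> 0"
    and "qfrac (\<lambda>N. Ad (\<Theta> N) (FF Q)) (inverse (qq Q) * inverse (FF Q))"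
    and "qfrac (\<lambda>N. Ad (\<Theta> N) (GG Q)) (inverse (qq Q) * inverse (GG Q))"
proof -
  define q where "q = qq Q"
  define F where "F = FF Q"
  define G where "G = GG Q"
  have nz: "q \<noteq> 0" "F \<noteq> 0" "G \<noteq> 0"
    using q_nonzero F_nonzero G_nonzero by (simp_all add: q_def F_def G_def)
  have FG: "F * G = q * G * F"
    using FG_commutation by (simp add: q_def F_def G_def)
  have qc: "x * q = q * x" "x * (q * y) = q * (x * y)" for x y
    unfolding q_def by (rule q_commute[symmetric], rule q_left_commute)
  have GF: "inverse G * F = q * F * inverse G"
    using FG nz unfolding q_def by (intro q_commuting_inverse)
  define x1 where "x1 = q * F * G"
  define x2 where "x2 = inverse G * F"
  define x3 where "x3 = q * F"
  have FF_G: "q * F * G * F = F * F * G"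
  proof -
    have "F * F * G = F * (q * G * F)"
      unfolding FG[symmetric] by (rule mult.assoc)
    then show ?thesis
      by (simp only: mult.assoc qc(2)[of F])
  qed
  have rel1: "F * x1 = q * x1 * F" "inverse G * x1 = q * x1 * inverse G"
  proof -
    have "F * (F * G) = q * (F * G) * F"
      using FF_G by (simp only: mult.assoc)
    then have "F * (q * (F * G)) = q * (q * (F * G)) * F"
      unfolding q_def by (rule q_commuting_scale) (rule qq_central)
    then show "F * x1 = q * x1 * F"
      by (simp only: x1_def mult.assoc)
    have "F * G * G = q * G * (F * G)"
      by (subst FG) (simp only: mult.assoc)
    then have "q * (F * G) * G = q * G * (q * (F * G))"
      unfolding q_def by (rule q_commuting_scale') (rule qq_central)
    then have "x1 * G = q * G * x1"
      by (simp only: x1_def mult.assoc)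
    then show "inverse G * x1 = q * x1 * inverse G"
      using nz unfolding q_def by (intro q_commuting_inverse)
  qed
  have rel2: "inverse F * x2 = q * x2 * inverse F"
  proof -
    have "x2 * F = q * F * x2"
      unfolding x2_def by (subst GF) (simp only: mult.assoc)
    with nz show ?thesis
      unfolding q_def by (intro q_commuting_inverse)
  qed
  have rel3: "inverse G * x3 = q * x3 * inverse G"
    unfolding x3_def using GF qq_central unfolding q_def by (rule q_commuting_scale)
  have x_nz: "x1 \<noteq> 0" "x2 \<noteq> 0" "x3 \<noteq> 0"
    using nz by (simp_all add: x1_def x2_def x3_def)
  have \<theta>_nz: "theta Q x1 N \<noteq> 0" "theta Q x2 N \<noteq> 0" "theta Q x3 N \<noteq> 0" for N
    using theta_nonzero[OF rel1(1)[unfolded q_def]] theta_nonzero[OF rel2[unfolded q_def]]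
      theta_nonzero[OF rel3[unfolded q_def]] x_nz nz by simp_all
  have \<Theta>: "\<Theta> N = theta Q x1 N * theta Q x2 N * theta Q x3 N ^ 4" for N
    by (simp add: \<Theta>_def x1_def x2_def x3_def q_def F_def G_def)
  then show "\<Theta> N \<noteq> 0" for N
    using \<theta>_nz by simp
  define \<kappa>1 where "\<kappa>1 = (\<lambda>N. Ad (theta Q x1 N))"
  define \<kappa>2 where "\<kappa>2 = (\<lambda>N u. \<kappa>1 N (Ad (theta Q x2 N) u))"
  have \<kappa>1: "hom_seq \<kappa>1"
    unfolding \<kappa>1_def by (rule hom_seq_Ad[OF hom_seq_id \<theta>_nz(1)])
  have \<kappa>2: "hom_seq \<kappa>2"
    unfolding \<kappa>2_def by (rule hom_seq_Ad[OF \<kappa>1 \<theta>_nz(2)])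
  have \<kappa>1_F: "qfrac (\<lambda>N. \<kappa>1 N F) (F * F * G)"
    using hom_seq_Ad_theta[OF hom_seq_id rel1(1)[unfolded q_def] qfrac_const qfrac_const nz(2) x_nz(1)] FF_G
    by (simp add: \<kappa>1_def x1_def)
  have \<kappa>1_G: "qfrac (\<lambda>N. \<kappa>1 N (inverse G)) (q * F)"
    using hom_seq_Ad_theta[OF hom_seq_id rel1(2)[unfolded q_def] qfrac_const qfrac_const _ x_nz(1)] nz
    by (simp add: \<kappa>1_def x1_def mult.assoc)
  define y where "y = q * F * (F * F * G)"
  have \<kappa>1_x2: "qfrac (\<lambda>N. \<kappa>1 N x2) y"
    unfolding x2_def y_def by (rule hom_seq_mult[OF \<kappa>1 \<kappa>1_G \<kappa>1_F])
  have "qfrac (\<lambda>N. \<kappa>1 N (inverse F)) (inverse (F * F * G))"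
    using nz by (intro hom_seq_inverse \<kappa>1 \<kappa>1_F) auto
  then have "qfrac (\<lambda>N. \<kappa>2 N (inverse F)) (y * inverse (F * F * G))"
    unfolding \<kappa>2_def
    by (rule hom_seq_Ad_theta[OF \<kappa>1 rel2[unfolded q_def] _ \<kappa>1_x2]) (use nz in \<open>auto simp: y_def\<close>)
  also have "y * inverse (F * F * G) = q * F"
  proof -
    have "F * F * G * inverse (F * F * G) = 1"
      using nz by (intro right_inverse) simp
    then show ?thesis
      unfolding y_def by (simp only: mult.assoc mult_1_right)
  qed
  finally have \<kappa>2_invF: "qfrac (\<lambda>N. \<kappa>2 N (inverse F)) (q * F)" .
  have \<kappa>2_F: "qfrac (\<lambda>N. \<kappa>2 N F) (inverse (q * F))"
    using hom_seq_inverse[OF \<kappa>2 \<kappa>2_invF] nz by simp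
  have "Ad (theta Q x2 N) x2 = x2" for N
    using \<theta>_nz by (intro Ad_commute theta_commute refl) (simp add: is_unit_of_division)
  then have "qfrac (\<lambda>N. \<kappa>2 N x2) y"
    using \<kappa>1_x2 by (simp add: \<kappa>2_def)
  \<comment> \<open>\<open>inverse G\<close> is recovered as \<open>x2 * inverse F\<close>, whose
    two factors have known limits.\<close>
  from hom_seq_mult[OF \<kappa>2 this \<kappa>2_invF] have \<kappa>2_G: "qfrac (\<lambda>N. \<kappa>2 N (inverse G)) (y * (q * F))"
    using nz by (simp add: x2_def mult.assoc)
  have Ad_x3: "Ad (theta Q x3 N) F = F" "Ad (theta Q x3 N) x3 = x3" for N
  proof -
    have "F * x3 = x3 * F"
      by (simp add: x3_def mult.assoc qc(2))
    with \<theta>_nz show "Ad (theta Q x3 N) F = F" "Ad (theta Q x3 N) x3 = x3"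
      by (auto intro!: Ad_commute theta_commute simp: is_unit_of_division)
  qed
  \<comment> \<open>One factor \<open>theta(q F)\<close>: it fixes \<open>F\<close>, and the outer
    maps send its argument \<open>q * F\<close> to \<open>q * inverse (q * F) = inverse F\<close>.
    So every application multiplies the image of \<open>inverse G\<close> by
    \<open>inverse F\<close> on the left and reproduces its own hypotheses.\<close>
  have step: "hom_seq (\<lambda>N u. \<kappa> N (Ad (theta Q x3 N) u)) \<and>
      qfrac (\<lambda>N. \<kappa> N (Ad (theta Q x3 N) F)) (inverse (q * F)) \<and>
      qfrac (\<lambda>N. \<kappa> N (Ad (theta Q x3 N) (inverse G))) (inverse F * h)"
    if \<kappa>: "hom_seq \<kappa>" "qfrac (\<lambda>N. \<kappa> N F) (inverse (q * F))" "qfrac (\<lambda>N. \<kappa> N (inverse G)) h" "h \<noteq> 0" for \<kappa> h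
  proof (intro conjI)
    show "hom_seq (\<lambda>N u. \<kappa> N (Ad (theta Q x3 N) u))"
      by (rule hom_seq_Ad[OF \<kappa>(1) \<theta>_nz(3)])
    show "qfrac (\<lambda>N. \<kappa> N (Ad (theta Q x3 N) F)) (inverse (q * F))"
      using \<kappa>(2) by (simp add: Ad_x3)
    have "qfrac (\<lambda>N. \<kappa> N x3) (q * inverse (q * F))"
      unfolding x3_def using \<kappa>(1) hom_seq_q[OF \<kappa>(1)] by (intro hom_seq_mult \<kappa>) (simp add: q_def)
    also have "q * inverse (q * F) = inverse F"
      using nz by (simp add: nonzero_inverse_mult_distrib flip: qc(2))
    finally show "qfrac (\<lambda>N. \<kappa> N (Ad (theta Q x3 N) (inverse G))) (inverse F * h)"
      using nz by (intro hom_seq_Ad_theta[OF \<kappa>(1) rel3[unfolded q_def] \<kappa>(3) _ \<kappa>(4)]) auto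
  qed
  define h where "h = y * (q * F)"
  have h: "h \<noteq> 0"
    using nz by (simp add: h_def y_def)
  note 3 = step[OF \<kappa>2 \<kappa>2_F \<kappa>2_G[folded h_def] h]
  note 4 = step[OF 3[THEN conjunct1] 3[THEN conjunct2, THEN conjunct1] 3[THEN conjunct2, THEN conjunct2]]
  note 5 = step[OF 4[THEN conjunct1] 4[THEN conjunct2, THEN conjunct1] 4[THEN conjunct2, THEN conjunct2]]
  note 6 = step[OF 5[THEN conjunct1] 5[THEN conjunct2, THEN conjunct1] 5[THEN conjunct2, THEN conjunct2]]
  have Ad_\<Theta>: "Ad (\<Theta> N) u = \<kappa>2 N (Ad (theta Q x3 N) (Ad (theta Q x3 N) (Ad (theta Q x3 N) (Ad (theta Q x3 N) u))))"
    for N u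
    using \<theta>_nz[of N] by (simp add: \<Theta> \<kappa>1_def \<kappa>2_def Ad_division_mult numeral_eq_Suc)
  have F_lim: "qfrac (\<lambda>N. Ad (\<Theta> N) F) (inverse (q * F))"
    using \<kappa>2_F by (simp add: Ad_\<Theta> Ad_x3)
  have G_lim: "qfrac (\<lambda>N. Ad (\<Theta> N) (inverse G)) (inverse F * (inverse F * (inverse F * (inverse F * h))))"
    using 6 nz h by (simp add: Ad_\<Theta>)
  have "inverse F * (inverse F * (inverse F * (inverse F * h))) = q * G"
  proof -
    have cancel: "inverse F * (F * u) = u" for u
      using nz by (simp flip: mult.assoc)
    have "F * (F * (F * (F * G))) = F * (F * (F * (q * G * F)))"
      by (simp only: FG)
    \<comment> \<open>Exactly four factors \<open>F\<close> stand in front of \<open>G\<close>,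
      matching the four applications of \<open>step\<close>.\<close>
    then have "h = q * (F * (F * (F * (F * G))))"
      unfolding h_def y_def by (simp only: mult.assoc qc(2)[of G] qc(2)[of F])
    then show ?thesis
      by (simp only: qc(2)[of "inverse F"] cancel)
  qed
  with G_lim have "qfrac (\<lambda>N. Ad (\<Theta> N) (inverse G)) (q * G)"
    by simp
  then have "qfrac (\<lambda>N. inverse (Ad (\<Theta> N) (inverse G))) (inverse (q * G))"
    using nz by (intro qfrac_inverse) auto
  then have "qfrac (\<lambda>N. Ad (\<Theta> N) G) (inverse (q * G))"
    using \<theta>_nz by (simp add: is_ring_hom_inverse[OF is_ring_hom_Ad] is_unit_of_division \<Theta>)
  moreover have "inverse (q * u) = inverse q * inverse u" for u
    using nz(1) qc(1)[of "inverse u"] commute_inverse[of "inverse u" q]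
    by (cases "u = 0") (simp_all add: nonzero_inverse_mult_distrib)
  ultimately show "qfrac (\<lambda>N. Ad (\<Theta> N) (FF Q)) (inverse (qq Q) * inverse (FF Q))"
    "qfrac (\<lambda>N. Ad (\<Theta> N) (GG Q)) (inverse (qq Q) * inverse (GG Q))"
    using F_lim by (simp_all add: q_def F_def G_def)
qed

text \<open>Both antiautomorphisms invert all parameters, up to their exchange of two indices. In
  the composite the inversions cancel and the two transpositions remain; these come from the swap
  exponentials, while the theta factors provide the action on \<open>F\<close> and
  \<open>G\<close>.\<close>

lemma Sig_Ad_tendsto:
  assumes \<sigma>01: "is_sigma01 Q \<sigma>01" and \<sigma>45: "is_sigma45 Q \<sigma>45"
    and \<epsilon>01: "is_exp Q (D_swap Q 0 1) \<epsilon>01" and \<epsilon>45: "is_exp Q (D_swap Q 4 5) \<epsilon>45"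
  shows "Ad_tendsto (Sig Q \<epsilon>01 \<epsilon>45) (\<sigma>01 \<circ> \<sigma>45)"
proof -
  obtain e where e: "implements \<epsilon>01 e" "\<And>c. e (sc Q c) = sc Q c" "e (qq Q) = qq Q" "e (FF Q) = FF Q"
    "e (GG Q) = GG Q" "\<And>k. k < 6 \<Longrightarrow> e (aa Q k) = aa Q (if k = 0 then 1 else if k = 1 then 0 else k)"
    using swap_implements[OF _ _ _ \<epsilon>01] by auto
  obtain e' where e': "implements \<epsilon>45 e'" "\<And>c. e' (sc Q c) = sc Q c" "e' (qq Q) = qq Q" "e' (FF Q) = FF Q"
    "e' (GG Q) = GG Q" "\<And>k. k < 6 \<Longrightarrow> e' (aa Q k) = aa Q (if k = 4 then 5 else if k = 5 then 4 else k)"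
    using swap_implements[OF _ _ _ \<epsilon>45] by auto
  define \<Theta> where "\<Theta> N = theta Q (qq Q * FF Q * GG Q) N * theta Q (inverse (GG Q) * FF Q) N * theta Q (qq Q * FF Q) N ^ 4" for N
  note \<Theta> = Ad_theta_limits[folded \<Theta>_def]
  have anti: "is_ring_antiautomorphism \<sigma>01" "is_ring_antiautomorphism \<sigma>45"
    using \<sigma>01 \<sigma>45 by (simp_all add: is_sigma01_def is_sigma45_def)
  note inv = antiauto_inverse[OF anti(1)]
  have impl: "implements (Sig Q \<epsilon>01 \<epsilon>45 N) (Ad (\<Theta> N) \<circ> e \<circ> e')" for N
    unfolding Sig_def \<Theta>_def[symmetric] by (intro implements_mult implements_emb \<Theta>(1) e(1) e'(1))
  have "conv_homs (\<lambda>N. Ad (\<Theta> N) \<circ> e \<circ> e') (\<sigma>01 \<circ> \<sigma>45)"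
  proof (rule conv_homsI)
    show "is_ring_hom (Ad (\<Theta> N) \<circ> e \<circ> e')" for N
      using impl by (simp add: implements_def)
    show "is_ring_hom (\<sigma>01 \<circ> \<sigma>45)"
      by (rule is_ring_hom_comp_antiauto[OF anti])
    show "(\<sigma>01 \<circ> \<sigma>45) (sc Q c) = sc Q c" for c
      using \<sigma>01 \<sigma>45 by (simp add: is_sigma01_def is_sigma45_def)
    show "(\<sigma>01 \<circ> \<sigma>45) (qq Q) = qq Q"
      using \<sigma>01 \<sigma>45 by (simp add: is_sigma01_def is_sigma45_def)
    show "qfrac (\<lambda>N. (Ad (\<Theta> N) \<circ> e \<circ> e') (aa Q k)) ((\<sigma>01 \<circ> \<sigma>45) (aa Q k))" if k: "k < 6" for k
    proof -
      have "k \<in> {0, 1, 2, 3, 4, 5}"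
        using k by auto
      then have "(\<sigma>01 \<circ> \<sigma>45) (aa Q k) = e (e' (aa Q k))" "central (e (e' (aa Q k)))"
        using \<sigma>01 \<sigma>45 by (auto simp: is_sigma01_def is_sigma45_def inv e e' a_nonzero aa_central)
      then show ?thesis
        using \<Theta>(1) by (simp add: Ad_central qfrac_const)
    qed
    show "qfrac (\<lambda>N. (Ad (\<Theta> N) \<circ> e \<circ> e') (FF Q)) ((\<sigma>01 \<circ> \<sigma>45) (FF Q))"
      using \<Theta>(2) \<sigma>01 \<sigma>45 by (simp add: e e' is_sigma01_def is_sigma45_def)
    \<comment> \<open>An antiautomorphism reverses the product; centrality of \<open>q\<close>
      restores the order.\<close>
    have "\<sigma>01 (inverse (qq Q) * inverse (GG Q)) = inverse (GG Q) * inverse (qq Q)"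
      using \<sigma>01 anti(1) q_nonzero G_nonzero
      by (simp add: is_sigma01_def is_ring_antiautomorphism_def inv)
    also have "\<dots> = inverse (qq Q) * inverse (GG Q)"
      using central_intros(4)[OF qq_central] by (simp add: central_def)
    finally show "qfrac (\<lambda>N. (Ad (\<Theta> N) \<circ> e \<circ> e') (GG Q)) ((\<sigma>01 \<circ> \<sigma>45) (GG Q))"
      using \<Theta>(3) \<sigma>45 by (simp add: e e' is_sigma45_def)
  qed (use \<Theta>(1) e e' in \<open>simp_all add: Ad_central sc_central qq_central\<close>)
  with impl show ?thesis
    unfolding Ad_tendsto_def by (intro exI[of _ "\<lambda>N. Ad (\<Theta> N) \<circ> e \<circ> e'"]) simp
qed

end

theorem theorem7:
  fixes Q :: "('f::division_ring, 'b::ring_1) qdata"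
    and s :: "nat \<Rightarrow> 'f \<Rightarrow> 'f" and \<sigma>01 \<sigma>45 :: "'f \<Rightarrow> 'f"
    and \<rho> :: "nat \<Rightarrow> 'b" and \<epsilon>01 \<epsilon>45 :: 'b
  assumes "quantum_skew_field Q"
    and "weyl_action Q s" and "is_sigma01 Q \<sigma>01" and "is_sigma45 Q \<sigma>45"
    and "letters Q"
    and "\<And>j. j < 6 \<Longrightarrow> is_exp Q (D_rho Q j) (\<rho> j)"
    and "is_exp Q (D_swap Q 0 1) \<epsilon>01" and "is_exp Q (D_swap Q 4 5) \<epsilon>45"
  shows "\<forall>\<phi>. Ad_lim Q
           (\<lambda>N. SS Q \<rho> 2 N * SS Q \<rho> 1 N * SS Q \<rho> 0 N * SS Q \<rho> 2 N *
                SS Q \<rho> 3 N * SS Q \<rho> 4 N * SS Q \<rho> 5 N * SS Q \<rho> 3 N *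
                Sig Q \<epsilon>01 \<epsilon>45 N)
           \<phi> (T3 s \<sigma>01 \<sigma>45 \<phi>)"
proof -
  interpret quantum_letters Q
    using assms(1,5) by unfold_locales
  have S: "Ad_tendsto (SS Q \<rho> j) (s j)" if "j < 6" for j
    using assms(2) that assms(6)[OF that] by (rule SS_Ad_tendsto)
  have "Ad_tendsto (\<lambda>N. SS Q \<rho> 2 N * SS Q \<rho> 1 N * SS Q \<rho> 0 N * SS Q \<rho> 2 N *
      SS Q \<rho> 3 N * SS Q \<rho> 4 N * SS Q \<rho> 5 N * SS Q \<rho> 3 N * Sig Q \<epsilon>01 \<epsilon>45 N) (T3 s \<sigma>01 \<sigma>45)"
    unfolding T3_def
    by (intro Ad_tendsto_mult Sig_Ad_tendsto[OF assms(3,4,7,8)] S) simp_all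
  then show ?thesis
    by (blast intro: Ad_tendsto_imp_Ad_lim)
qed

end
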